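(* Let $n\ge 2$ and $r\ge 1$. If $\mathrm{Z}:\mathcal{P}(\mathbb{Z}^n)\to\mathbb{T}^r$ is a translation covariant valuation, then there exist $\mathrm{Z}_i:\mathcal{P}(\mathbb{Z}^n)\to\mathbb{T}^r$ for $i=0,\dots,n+r$ such that $$\mathrm{Z}(kP)=\sum_{i=0}^{n+r}\mathrm{Z}_i(P)\,k^i$$ for every $k\in\mathbb{N}$ and $P\in\mathcal{P}(\mathbb{Z}^n)$. For each $i$, the function $\mathrm{Z}_i$ is a translation covariant and $i$-homogeneous valuation.
   Context: $\mathbb{N}$ is the set of non-negative integers. $\mathcal{P}(\mathbb{Z}^n)$ is the set of lattice polytopes in $\mathbb{R}^n$, i.e. convex polytopes with vertices in $\mathbb{Z}^n$ (the empty set is included). $\mathbb{T}^r$ is the vector space of symmetric tensors of rank $r$ on $\mathbb{R}^n$, identified via the scalar product with symmetric $r$-linear functionals on $(\mathbb{R}^n)^r$; $\mathbb{T}^0=\mathbb{R}$. For $x\in\mathbb{R}^n$, $x^r\in\mathbb{T}^r$ is the $r$-fold symmetric tensor product, $x^r(v_1,\dots,v_r)=(x\cdot v_1)\cdots(x\cdot v_r)$, and $x^0=1$. Products of symmetric tensors are symmetric tensor products: for $A\in\mathbb{T}^{p}$, $B\in\mathbb{T}^{q}$, $(AB)(v_1,\dots,v_{p+q})=\frac{1}{(p+q)!}\sum_\sigma A(v_{\sigma(1)},\dots,v_{\sigma(p)})B(v_{\sigma(p+1)},\dots,v_{\sigma(p+q)})$, summing over all permutations $\sigma$ of $1,\dots,p+q$.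 A function $\mathrm{Z}:\mathcal{P}(\mathbb{Z}^n)\to\mathbb{T}^r$ is: a valuation if $\mathrm{Z}(\emptyset)=0$ and $\mathrm{Z}(P)+\mathrm{Z}(Q)=\mathrm{Z}(P\cup Q)+\mathrm{Z}(P\cap Q)$ whenever $P,Q,P\cup Q,P\cap Q\in\mathcal{P}(\mathbb{Z}^n)$; $i$-homogeneous if $\mathrm{Z}(kP)=k^i\mathrm{Z}(P)$ for all $k\in\mathbb{N}$ and $P\in\mathcal{P}(\mathbb{Z}^n)$ (with $0^0=1$). A valuation $\mathrm{Z}$ is translation covariant if there are functions $\mathrm{Z}^j:\mathcal{P}(\mathbb{Z}^n)\to\mathbb{T}^j$, $j=0,\dots,r$, such that $\mathrm{Z}(P+y)=\sum_{j=0}^r\mathrm{Z}^{r-j}(P)\frac{y^j}{j!}$ for all $y\in\mathbb{Z}^n$ and $P\in\mathcal{P}(\mathbb{Z}^n)$. *)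

theory Defs
  imports "HOL-Analysis.Analysis"
begin

definition integer_lattice :: "(real ^ 'n) set" where
  "integer_lattice = {x. \<forall>i. x $ i \<in> \<int>}"

definition lattice_polytopes :: "(real ^ 'n) set set" where
  "lattice_polytopes = {P. polytope P \<and> {x. x extreme_point_of P} \<subseteq> integer_lattice}"

text \<open>
  A symmetric tensor of rank r is an r-linear symmetric functional, written as a functional
  on sequences of vectors that reads only the entries \<open>v 0, \<dots>, v (r - 1)\<close>. The remaining entries
  are irrelevant, so HOL equality of elements of \<open>sym_tensors r\<close> is equality of tensors, the
  vector space operations are pointwise, and \<open>sym_tensors 0\<close> consists of the constants.
\<close>

type_synonym 'n tensor = "(nat \<Rightarrow> (real, 'n) vec) \<Rightarrow> real"

definition sym_tensors :: "nat \<Rightarrow> ('n::finite) tensor set" where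
  "sym_tensors r = {T.
     (\<forall>v w. (\<forall>i<r. v i = w i) \<longrightarrow> T v = T w) \<and>
     (\<forall>v. \<forall>i<r. linear (\<lambda>x. T (v(i := x)))) \<and>
     (\<forall>v \<sigma>. \<sigma> permutes {..<r} \<longrightarrow> T (v \<circ> \<sigma>) = T v)}"

definition tensor_power :: "real ^ 'n \<Rightarrow> nat \<Rightarrow> 'n tensor" where
  "tensor_power x r = (\<lambda>v. \<Prod>i<r. x \<bullet> v i)"

text \<open>Symmetric product of a tensor of rank p and a tensor of rank q.\<close>

definition tensor_mult :: "nat \<Rightarrow> nat \<Rightarrow> ('n::finite) tensor \<Rightarrow> 'n tensor \<Rightarrow> 'n tensor" where
  "tensor_mult p q A B = (\<lambda>v. (1 / fact (p + q)) *
     (\<Sum>\<sigma> | \<sigma> permutes {..<p + q}. A (\<lambda>i. v (\<sigma> i)) * B (\<lambda>i. v (\<sigma> (p + i)))))"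

definition valuation :: "nat \<Rightarrow> ((real ^ 'n) set \<Rightarrow> 'n tensor) \<Rightarrow> bool" where
  "valuation r Z \<longleftrightarrow> Z \<in> lattice_polytopes \<rightarrow> sym_tensors r \<and>
     Z {} = (\<lambda>v. 0) \<and>
     (\<forall>P Q. P \<in> lattice_polytopes \<and> Q \<in> lattice_polytopes \<and>
            P \<union> Q \<in> lattice_polytopes \<and> P \<inter> Q \<in> lattice_polytopes \<longrightarrow>
        (\<lambda>v. Z P v + Z Q v) = (\<lambda>v. Z (P \<union> Q) v + Z (P \<inter> Q) v))"

definition homogeneous :: "nat \<Rightarrow> ((real ^ 'n) set \<Rightarrow> 'n tensor) \<Rightarrow> bool" where
  "homogeneous i Z \<longleftrightarrow>
     (\<forall>k::nat. \<forall>P\<in>lattice_polytopes.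
        Z ((\<lambda>x. real k *\<^sub>R x) ` P) = (\<lambda>v. real k ^ i * Z P v))"

definition translation_covariant :: "nat \<Rightarrow> ((real ^ 'n) set \<Rightarrow> 'n tensor) \<Rightarrow> bool" where
  "translation_covariant r Z \<longleftrightarrow>
     (\<exists>Za :: nat \<Rightarrow> (real ^ 'n) set \<Rightarrow> 'n tensor.
        (\<forall>j\<le>r. Za j \<in> lattice_polytopes \<rightarrow> sym_tensors j) \<and>
        (\<forall>P\<in>lattice_polytopes. \<forall>y\<in>integer_lattice.
           Z ((\<lambda>x. x + y) ` P) =
             (\<lambda>v. \<Sum>j\<le>r. tensor_mult (r - j) j (Za (r - j) P) (tensor_power y j) v / fact j)))"

end

theory Submission
  imports Defs
begin

text \<open>
  Fix the arguments of the tensors and regard \<open>f P = Z P v\<close> as a real functional. It is additive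
  for two lattice polytopes whose union and intersection are lattice polytopes, and
  \<open>y \<mapsto> f (P + y)\<close> is a polynomial of degree at most \<open>r\<close> on the lattice. The main point is that
  \<open>f (k P)\<close> is a polynomial in \<open>k\<close> of degree at most \<open>CARD('n) + r\<close>.

  Additivity for two polytopes does not permit cutting a lattice polytope into lattice simplices,
  and inclusion-exclusion is not at hand. The proof avoids triangulations. It uses that the canonical
  dissection of a dilated simplex survives affine images: if a simplex is cut by a hyperplane, the
  images of the two parts under an affine map meet exactly in the image of the intersection, because
  a segment that joins points of the two parts crosses the cut. Every polytope is an affine image of
  a simplex.

  In its first form (\<open>cone_slice\<close>), the dissection splits \<open>(k + 1) S + Q\<close>, where \<open>S\<close> is the convex hull of
  \<open>R\<close> and \<open>x\<close>, into \<open>k S + Q + x\<close> and \<open>k R + S + Q\<close> with intersection \<open>k R + Q + x\<close>. Thus the difference of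
  the sequence \<open>f (k S + Q)\<close> is governed by fewer vertices or by a translation difference of \<open>f\<close>, and
  an induction gives polynomiality in \<open>k\<close> with a degree that is at most \<open>r\<close> plus the number of vertices
  minus one (\<open>poly_seq_dilate_plus\<close>). In its second form (\<open>segment_through_convex\<close>), it cuts the hull of
  more than \<open>CARD('n) + 1\<close> points at a point of an edge that an integer affine dependence singles out.
  Repeated cuts end at hulls of fewer points. The cut points are rational; because
  polynomiality is already known, passing to a multiple of the polytope does not change the degree
  (\<open>poly_seq_dependent_hull\<close>, \<open>poly_seq_dilate\<close>).

  Finally, the coefficients of a polynomial of bounded degree are fixed linear combinations of its
  values at \<open>0, \<dots>, N\<close> (\<open>poly_interpolation\<close>). Hence the homogeneous components of \<open>Z\<close> are linear combinations
  of the functionals \<open>P \<mapsto> Z (k P)\<close> with coefficients independent of \<open>P\<close> and \<open>v\<close>, and they inherit from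
  these the symmetry of the tensors, additivity, and translation covariance.
\<close>

section \<open>Lattice polytopes\<close>

lemma lattice_polytope_iff:
  "P \<in> lattice_polytopes \<longleftrightarrow> (\<exists>V. finite V \<and> V \<subseteq> integer_lattice \<and> P = convex hull V)"
proof
  assume P: "P \<in> lattice_polytopes"
  then have "polytope P" and ext: "{x. x extreme_point_of P} \<subseteq> integer_lattice"
    by (auto simp: lattice_polytopes_def)
  from \<open>polytope P\<close> obtain W where W: "finite W" "P = convex hull W"
    by (auto simp: polytope_def)
  then have "{x. x extreme_point_of P} \<subseteq> W"
    using extreme_point_of_convex_hull by fastforce
  then have "finite {x. x extreme_point_of P}"
    using W finite_subset by blast
  moreover have "P = convex hull {x. x extreme_point_of P}"
    using Krein_Milman_polytope[OF W(1)] W(2) by simp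
  ultimately show "\<exists>V. finite V \<and> V \<subseteq> integer_lattice \<and> P = convex hull V"
    using ext by (intro exI[of _ "{x. x extreme_point_of P}"]) auto
next
  assume "\<exists>V. finite V \<and> V \<subseteq> integer_lattice \<and> P = convex hull V"
  then obtain V where V: "finite V" "V \<subseteq> integer_lattice" "P = convex hull V"
    by blast
  then have "{x. x extreme_point_of P} \<subseteq> V"
    using extreme_point_of_convex_hull by fastforce
  then show "P \<in> lattice_polytopes"
    using V by (auto simp: lattice_polytopes_def polytope_def)
qed

lemma hull_in_lattice_polytopes:
  "finite V \<Longrightarrow> V \<subseteq> integer_lattice \<Longrightarrow> convex hull V \<in> lattice_polytopes"
  using lattice_polytope_iff by blast

lemma integer_lattice_add: "x \<in> integer_lattice \<Longrightarrow> y \<in> integer_lattice \<Longrightarrow> x + y \<in> integer_lattice"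
  by (auto simp: integer_lattice_def)

lemma integer_lattice_scale: "x \<in> integer_lattice \<Longrightarrow> c \<in> \<int> \<Longrightarrow> c *\<^sub>R x \<in> integer_lattice"
  by (auto simp: integer_lattice_def)

lemma integer_lattice_0: "0 \<in> integer_lattice"
  by (auto simp: integer_lattice_def)

lemma lattice_polytopes_plus:
  assumes "P \<in> lattice_polytopes" "Q \<in> lattice_polytopes"
  shows "P + Q \<in> lattice_polytopes"
proof -
  obtain V W where "finite V" "V \<subseteq> integer_lattice" "P = convex hull V"
    and "finite W" "W \<subseteq> integer_lattice" "Q = convex hull W"
    using assms by (auto simp: lattice_polytope_iff)
  then have "P + Q = convex hull (V + W)" "finite (V + W)" "V + W \<subseteq> integer_lattice"
    by (simp add: convex_hull_set_plus, simp add: finite_set_plus,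
        auto elim!: set_plus_elim intro!: integer_lattice_add)
  then show ?thesis
    by (auto simp: lattice_polytope_iff)
qed

lemma lattice_polytopes_scale:
  assumes "P \<in> lattice_polytopes" "c \<in> \<int>"
  shows "(*\<^sub>R) c ` P \<in> lattice_polytopes"
proof -
  obtain V where "finite V" "V \<subseteq> integer_lattice" "P = convex hull V"
    using assms(1) by (auto simp: lattice_polytope_iff)
  then have "(*\<^sub>R) c ` P = convex hull ((*\<^sub>R) c ` V)" "finite ((*\<^sub>R) c ` V)"
     "(*\<^sub>R) c ` V \<subseteq> integer_lattice"
    using assms(2) by (auto simp: convex_hull_scaling intro: integer_lattice_scale)
  then show ?thesis
    by (auto simp: lattice_polytope_iff)
qed

lemma lattice_polytopes_singleton: "y \<in> integer_lattice \<Longrightarrow> {y} \<in> lattice_polytopes"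
  using hull_in_lattice_polytopes[of "{y}"] by auto

lemma lattice_polytope_convex: "P \<in> lattice_polytopes \<Longrightarrow> convex P"
  and lattice_polytope_closed: "P \<in> lattice_polytopes \<Longrightarrow> closed P"
  by (auto simp: lattice_polytopes_def polytope_imp_convex polytope_imp_closed)

section \<open>Dissections of convex sets\<close>

lemma convex_hull_insert_convex:
  assumes "convex C" "C \<noteq> {}"
  shows "convex hull (insert x C) = {a *\<^sub>R x + b *\<^sub>R c | a b c. a \<ge> 0 \<and> b \<ge> 0 \<and> a + b = 1 \<and> c \<in> C}"
  using convex_hull_insert[OF assms(2), of x] assms(1) by (auto simp: hull_same)

lemma Minkowski_scale:
  assumes "convex S" "a \<ge> 0" "b \<ge> 0"
  shows "(*\<^sub>R) (a + b) ` S = (*\<^sub>R) a ` S + (*\<^sub>R) b ` S"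
proof
  show "(*\<^sub>R) (a + b) ` S \<subseteq> (*\<^sub>R) a ` S + (*\<^sub>R) b ` S"
    by (auto simp: scaleR_add_left intro!: set_plus_intro)
  show "(*\<^sub>R) a ` S + (*\<^sub>R) b ` S \<subseteq> (*\<^sub>R) (a + b) ` S"
  proof
    fix z assume "z \<in> (*\<^sub>R) a ` S + (*\<^sub>R) b ` S"
    then obtain s t where st: "s \<in> S" "t \<in> S" "z = a *\<^sub>R s + b *\<^sub>R t"
      by (auto elim!: set_plus_elim)
    show "z \<in> (*\<^sub>R) (a + b) ` S"
    proof (cases "a + b = 0")
      case True
      then have "a = 0" "b = 0" using assms by auto
      then show ?thesis using st by force
    next
      case False
      then have "(a/(a+b)) *\<^sub>R s + (b/(a+b)) *\<^sub>R t \<in> S"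
        using assms st by (intro convexD) (auto simp: add_divide_distrib [symmetric])
      moreover have "z = (a+b) *\<^sub>R ((a/(a+b)) *\<^sub>R s + (b/(a+b)) *\<^sub>R t)"
        using False by (simp add: st scaleR_add_right)
      ultimately show ?thesis by blast
    qed
  qed
qed

text \<open>
  A simplex is cut along the hyperplane through a point \<open>u\<close> of one edge and through the opposite
  face. Here the pieces may be arbitrarily degenerate: if the segment from \<open>x\<close> to \<open>y\<close> meets the
  convex set \<open>C\<close>, any point that lies in both pieces can be written as a convex combination in
  which \<open>x\<close> and \<open>y\<close> occur in the proportion that makes up \<open>u\<close>.
\<close>

lemma segment_through_convex:
  fixes C :: "'a::real_vector set"
  assumes C: "convex C" and u: "u \<in> C" and t: "0 \<le> t" "t \<le> 1" and ut: "u = (1 - t) *\<^sub>R x + t *\<^sub>R y"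
  shows "convex hull (insert x (insert y C)) = convex hull (insert x C) \<union> convex hull (insert y C)"
    and "convex hull (insert x C) \<inter> convex hull (insert y C) = C"
proof -
  have ne: "C \<noteq> {}" using u by auto
  note hull = convex_hull_insert_convex[OF C ne]
  show "convex hull (insert x C) \<inter> convex hull (insert y C) = C"
  proof
    show "C \<subseteq> convex hull (insert x C) \<inter> convex hull (insert y C)"
      by (auto intro: hull_inc)
    show "convex hull (insert x C) \<inter> convex hull (insert y C) \<subseteq> C"
    proof
      fix z assume "z \<in> convex hull (insert x C) \<inter> convex hull (insert y C)"
      then have zx: "z \<in> convex hull (insert x C)" and zy: "z \<in> convex hull (insert y C)"
        by auto
      obtain a b c where 1: "z = a *\<^sub>R x + b *\<^sub>R c" "a \<ge> 0" "b \<ge> 0" "a + b = 1" "c \<in> C"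
        using zx unfolding hull by blast
      obtain a' b' c' where 2: "z = a' *\<^sub>R y + b' *\<^sub>R c'" "a' \<ge> 0" "b' \<ge> 0" "a' + b' = 1" "c' \<in> C"
        using zy unfolding hull by blast
      note z = 1(1) 2(1) and ab = 1(2-) 2(2-)
      define s where "s = t * a + (1 - t) * a'"
      have s0: "s \<ge> 0" using t ab by (simp add: s_def)
      show "z \<in> C"
      proof (cases "s = 0")
        case True
        then have "t * a = 0" "(1 - t) * a' = 0"
          using t ab unfolding s_def by (metis add_nonneg_eq_0_iff diff_ge_0_iff_ge mult_nonneg_nonneg)+
        then consider "a = 0" | "a' = 0" by force
        then show ?thesis using z ab by cases auto
      next
        case False
        then have s: "s > 0" using s0 by simp
        let ?p = "t * a" and ?q = "(1 - t) * a'"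
        \<comment> \<open>Weights chosen such that the contributions of x and y combine to a multiple of u.\<close>
        have "s *\<^sub>R z = ?q *\<^sub>R z + ?p *\<^sub>R z"
          by (simp add: s_def scaleR_add_left)
        also have "\<dots> = ?q *\<^sub>R (a *\<^sub>R x + b *\<^sub>R c) + ?p *\<^sub>R (a' *\<^sub>R y + b' *\<^sub>R c')"
          using z by metis
        also have "\<dots> = (a * a') *\<^sub>R u + (?q * b) *\<^sub>R c + (?p * b') *\<^sub>R c'"
          by (simp add: ut algebra_simps)
        finally have sz: "s *\<^sub>R z = (a * a') *\<^sub>R u + (?q * b) *\<^sub>R c + (?p * b') *\<^sub>R c'" .
        have sum: "a * a' + ?q * b + ?p * b' = s"
        proof -
          have b: "b = 1 - a" "b' = 1 - a'" using ab by auto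
          show ?thesis unfolding b s_def by (simp add: algebra_simps)
        qed
        have "z = (1/s) *\<^sub>R (s *\<^sub>R z)" using s by simp
        also have "\<dots> = (a * a' / s) *\<^sub>R u + (?q * b / s) *\<^sub>R c + (?p * b' / s) *\<^sub>R c'"
          unfolding sz by (simp add: scaleR_add_right)
        also have "\<dots> \<in> convex hull {u, c, c'}"
          unfolding convex_hull_3 using s ab t sum
          by (intro CollectI exI[of _ "a * a' / s"] exI[of _ "?q * b / s"] exI[of _ "?p * b' / s"])
            (auto simp flip: add_divide_distrib)
        also have "\<dots> \<subseteq> C"
          using ab u C by (intro hull_minimal) auto
        finally show ?thesis .
      qed
    qed
  qed
  have half: "\<alpha> *\<^sub>R x + \<beta> *\<^sub>R y + \<gamma> *\<^sub>R c \<in> convex hull (insert x C)"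
    if "c \<in> C" "\<alpha> \<ge> 0" "\<beta> \<ge> 0" "\<gamma> \<ge> 0" "\<alpha> + \<beta> + \<gamma> = 1" "\<beta> * (1 - t) \<le> \<alpha> * t" "t > 0"
      "u = (1 - t) *\<^sub>R x + t *\<^sub>R y" "u \<in> C" for \<alpha> \<beta> \<gamma> c t x y
  proof -
    have "(\<beta>/t) *\<^sub>R u = (\<beta>*(1-t)/t) *\<^sub>R x + \<beta> *\<^sub>R y"
      unfolding \<open>u = (1 - t) *\<^sub>R x + t *\<^sub>R y\<close> using \<open>t > 0\<close> by (simp add: scaleR_add_right)
    then have "\<beta> *\<^sub>R y = (\<beta>/t) *\<^sub>R u - (\<beta>*(1-t)/t) *\<^sub>R x"
      by simp
    then have "\<alpha> *\<^sub>R x + \<beta> *\<^sub>R y + \<gamma> *\<^sub>R c = (\<alpha> - \<beta>*(1-t)/t) *\<^sub>R x + (\<beta>/t) *\<^sub>R u + \<gamma> *\<^sub>R c"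
      by (simp add: algebra_simps)
    also have "\<dots> \<in> convex hull {x, u, c}"
    proof -
      have "\<alpha> - \<beta>*(1-t)/t \<ge> 0" using that by (simp add: field_simps)
      moreover have "\<beta>/t - \<beta>*(1-t)/t = \<beta>"
        using \<open>t > 0\<close> by (simp flip: diff_divide_distrib add: right_diff_distrib)
      then have "\<alpha> - \<beta>*(1-t)/t + \<beta>/t + \<gamma> = 1" using that(5) by linarith
      moreover have "\<beta>/t \<ge> 0" using that by simp
      ultimately show ?thesis
        unfolding convex_hull_3 using \<open>\<gamma> \<ge> 0\<close> by blast
    qed
    also have "\<dots> \<subseteq> convex hull (insert x C)"
      using that by (intro hull_mono) auto
    finally show ?thesis .
  qed
  show "convex hull (insert x (insert y C)) = convex hull (insert x C) \<union> convex hull (insert y C)"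
  proof
    show "convex hull (insert x C) \<union> convex hull (insert y C) \<subseteq> convex hull (insert x (insert y C))"
      by (intro Un_least hull_mono) auto
    show "convex hull (insert x (insert y C)) \<subseteq> convex hull (insert x C) \<union> convex hull (insert y C)"
    proof
      fix z assume "z \<in> convex hull (insert x (insert y C))"
      then obtain p q w where w: "z = p *\<^sub>R x + q *\<^sub>R w" "p \<ge> 0" "q \<ge> 0" "p + q = 1"
          "w \<in> convex hull (insert y C)"
        using convex_hull_insert[of "insert y C" x] by auto
      then obtain a b c where c: "w = a *\<^sub>R y + b *\<^sub>R c" "a \<ge> 0" "b \<ge> 0" "a + b = 1" "c \<in> C"
        unfolding hull by auto
      have z: "z = p *\<^sub>R x + (q * a) *\<^sub>R y + (q * b) *\<^sub>R c"
        by (simp add: w c algebra_simps)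
      have sum: "p + q * a + q * b = 1"
        using w(4) c(4) by (simp flip: distrib_left add: add.assoc)
      have nn: "q * a \<ge> 0" "q * b \<ge> 0" using w c by auto
      have "z \<in> convex hull (insert x C)" if "q * a * (1 - t) \<le> p * t" "t > 0"
        unfolding z using half[OF c(5) w(2) nn sum that(1,2) ut u] .
      moreover have "z \<in> convex hull (insert y C)" if "p * t \<le> q * a * (1 - t)" "t < 1"
      proof -
        have "(q * a) *\<^sub>R y + p *\<^sub>R x + (q * b) *\<^sub>R c \<in> convex hull (insert y C)"
          by (rule half[where t = "1 - t"]) (use c w nn sum that ut u in \<open>auto simp: add_ac\<close>)
        then show ?thesis by (simp add: z add_ac)
      qed
      moreover have "z \<in> convex hull (insert y C)" if "t = 0"
      proof -
        have "x \<in> C" using ut u that by simp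
        then have "convex hull (insert x (insert y C)) = convex hull (insert y C)"
          by (simp add: insert_absorb)
        then show ?thesis using \<open>z \<in> convex hull (insert x (insert y C))\<close> by simp
      qed
      moreover have "z \<in> convex hull (insert x C)" if "t = 1"
      proof -
        have "y \<in> C" using ut u that by simp
        then have "convex hull (insert x (insert y C)) = convex hull (insert x C)"
          by (simp add: insert_absorb)
        then show ?thesis using \<open>z \<in> convex hull (insert x (insert y C))\<close> by simp
      qed
      ultimately show "z \<in> convex hull (insert x C) \<union> convex hull (insert y C)"
        using t by (metis Un_iff linorder_le_cases order_le_less)
    qed
  qed
qed

text \<open>
  The cone \<open>(k + 1) S\<close> over \<open>R\<close> is cut where the coefficient of the apex \<open>x\<close> equals 1. Above the cut
  lies a translate of \<open>k S\<close>; below it lies the slab \<open>k R + S\<close>. Adding \<open>Q\<close> everywhere makes the identity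
  usable in an induction that removes the vertices of \<open>S\<close> one by one. As \<open>R\<close> may be degenerate and even
  contain \<open>x\<close>, the coefficient of \<open>x\<close> is a property of a representation and not of the point; two
  representations are averaged to reach the coefficient 1.
\<close>

lemma cone_slice:
  fixes R :: "'a::real_vector set"
  assumes R: "convex R" "R \<noteq> {}" and Q: "convex Q"
    and S: "S = convex hull (insert x R)" and k: "k \<ge> 0"
  shows "(*\<^sub>R) (k + 1) ` S + Q = ((*\<^sub>R) k ` S + Q + {x}) \<union> ((*\<^sub>R) k ` R + (S + Q))"
    and "((*\<^sub>R) k ` S + Q + {x}) \<inter> ((*\<^sub>R) k ` R + (S + Q)) = (*\<^sub>R) k ` R + Q + {x}"
proof -
  note hull = convex_hull_insert_convex[OF R, of x, folded S]
  have cS: "convex S" and xS: "x \<in> S" and RS: "R \<subseteq> S"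
    unfolding S by (auto intro: hull_inc)
  have split: "(*\<^sub>R) (k + 1) ` S = (*\<^sub>R) k ` S + S"
    using Minkowski_scale[OF cS k, of 1] by simp
  have lower: "(*\<^sub>R) k ` S + Q + {x} \<subseteq> (*\<^sub>R) (k + 1) ` S + Q"
  proof -
    have "(*\<^sub>R) k ` S + Q + {x} = (*\<^sub>R) k ` S + {x} + Q"
      by (simp add: add_ac)
    also have "\<dots> \<subseteq> (*\<^sub>R) k ` S + S + Q"
      using xS by (intro set_plus_mono2) auto
    finally show ?thesis by (simp add: split)
  qed
  have upper: "(*\<^sub>R) k ` R + (S + Q) \<subseteq> (*\<^sub>R) (k + 1) ` S + Q"
    unfolding split add.assoc[symmetric] using RS by (intro set_plus_mono2) auto
  show "(*\<^sub>R) (k + 1) ` S + Q = ((*\<^sub>R) k ` S + Q + {x}) \<union> ((*\<^sub>R) k ` R + (S + Q))"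
  proof (intro equalityI Un_least lower upper subsetI)
    fix z assume "z \<in> (*\<^sub>R) (k + 1) ` S + Q"
    then obtain a b \<rho> q where z: "z = (k + 1) *\<^sub>R (a *\<^sub>R x + b *\<^sub>R \<rho>) + q" "a \<ge> 0" "b \<ge> 0" "a + b = 1"
        "\<rho> \<in> R" "q \<in> Q"
      unfolding hull by (auto elim!: set_plus_elim)
    \<comment> \<open>The coefficient of x decides on which side of the cut the point lies.\<close>
    show "z \<in> ((*\<^sub>R) k ` S + Q + {x}) \<union> ((*\<^sub>R) k ` R + (S + Q))"
    proof (cases "(k + 1) * a \<ge> 1")
      case True
      have "(k + 1) *\<^sub>R (a *\<^sub>R x + b *\<^sub>R \<rho>) - x \<in> (*\<^sub>R) k ` S"
      proof (cases "k = 0")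
        case True
        then have "a = 1" "b = 0" using \<open>(k + 1) * a \<ge> 1\<close> z by auto
        then show ?thesis using True xS by force
      next
        case False
        then have k: "k > 0" using k by simp
        have "(k + 1) *\<^sub>R (a *\<^sub>R x + b *\<^sub>R \<rho>) - x = ((k + 1) * a - 1) *\<^sub>R x + ((k + 1) * b) *\<^sub>R \<rho>"
          by (simp add: algebra_simps)
        also have "\<dots> = k *\<^sub>R ((((k + 1) * a - 1) / k) *\<^sub>R x + ((k + 1) * b / k) *\<^sub>R \<rho>)"
          using k by (simp add: scaleR_add_right)
        finally have "(k + 1) *\<^sub>R (a *\<^sub>R x + b *\<^sub>R \<rho>) - x =
            k *\<^sub>R ((((k + 1) * a - 1) / k) *\<^sub>R x + ((k + 1) * b / k) *\<^sub>R \<rho>)" .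
        moreover have "(((k + 1) * a - 1) / k) *\<^sub>R x + ((k + 1) * b / k) *\<^sub>R \<rho> \<in> S"
        proof -
          have "((k + 1) * a - 1) / k + (k + 1) * b / k = ((k + 1) * (a + b) - 1) / k"
            by (simp add: add_divide_distrib diff_divide_distrib algebra_simps)
          then have "((k + 1) * a - 1) / k + (k + 1) * b / k = 1"
            using k z by simp
          then show ?thesis
            unfolding hull using True k z
            by (intro CollectI exI[of _ "((k + 1) * a - 1) / k"] exI[of _ "(k + 1) * b / k"] exI[of _ \<rho>]) auto
        qed
        ultimately show ?thesis by blast
      qed
      then have "((k + 1) *\<^sub>R (a *\<^sub>R x + b *\<^sub>R \<rho>) - x) + q + x \<in> (*\<^sub>R) k ` S + Q + {x}"
        using z by (intro set_plus_intro) auto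
      then show ?thesis by (simp add: z)
    next
      case False
      define s where "s = (k + 1) * b - k"
      have s: "s = 1 - (k + 1) * a"
      proof -
        have b: "b = 1 - a" using z by simp
        show ?thesis unfolding s_def b by (simp add: algebra_simps)
      qed
      have "z = k *\<^sub>R \<rho> + ((((k + 1) * a) *\<^sub>R x + s *\<^sub>R \<rho>) + q)"
        by (simp add: z(1) s_def algebra_simps)
      moreover have "((k + 1) * a) *\<^sub>R x + s *\<^sub>R \<rho> \<in> S"
        unfolding hull using False k z s
        by (intro CollectI exI[of _ "(k + 1) * a"] exI[of _ s] exI[of _ \<rho>]) auto
      then have "k *\<^sub>R \<rho> + ((((k + 1) * a) *\<^sub>R x + s *\<^sub>R \<rho>) + q) \<in> (*\<^sub>R) k ` R + (S + Q)"
        using z(5,6) by (intro set_plus_intro imageI)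
      ultimately have "z \<in> (*\<^sub>R) k ` R + (S + Q)" by (simp only:)
      then show ?thesis by simp
    qed
  qed
  show "((*\<^sub>R) k ` S + Q + {x}) \<inter> ((*\<^sub>R) k ` R + (S + Q)) = (*\<^sub>R) k ` R + Q + {x}"
  proof
    have "(*\<^sub>R) k ` R + Q + {x} \<subseteq> (*\<^sub>R) k ` S + Q + {x}"
      using RS by (intro set_plus_mono2) auto
    moreover have "(*\<^sub>R) k ` R + Q + {x} \<subseteq> (*\<^sub>R) k ` R + (S + Q)"
    proof -
      have "(*\<^sub>R) k ` R + Q + {x} = (*\<^sub>R) k ` R + ({x} + Q)" by (simp add: add_ac)
      also have "\<dots> \<subseteq> (*\<^sub>R) k ` R + (S + Q)"
        using xS by (intro set_plus_mono2) auto
      finally show ?thesis .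
    qed
    ultimately show "(*\<^sub>R) k ` R + Q + {x} \<subseteq> ((*\<^sub>R) k ` S + Q + {x}) \<inter> ((*\<^sub>R) k ` R + (S + Q))"
      by blast
    show "((*\<^sub>R) k ` S + Q + {x}) \<inter> ((*\<^sub>R) k ` R + (S + Q)) \<subseteq> (*\<^sub>R) k ` R + Q + {x}"
    proof
      fix z assume z: "z \<in> ((*\<^sub>R) k ` S + Q + {x}) \<inter> ((*\<^sub>R) k ` R + (S + Q))"
      then obtain a b \<rho> q where 1: "z = k *\<^sub>R (a *\<^sub>R x + b *\<^sub>R \<rho>) + q + x" "a \<ge> 0" "b \<ge> 0" "a + b = 1"
          "\<rho> \<in> R" "q \<in> Q"
        unfolding hull by (auto elim!: set_plus_elim)
      from z obtain a' b' \<rho>1 \<rho>' q' where 2: "z = k *\<^sub>R \<rho>1 + ((a' *\<^sub>R x + b' *\<^sub>R \<rho>') + q')" "a' \<ge> 0"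
          "b' \<ge> 0" "a' + b' = 1" "\<rho>1 \<in> R" "\<rho>' \<in> R" "q' \<in> Q"
        unfolding hull by (auto elim!: set_plus_elim)
      \<comment> \<open>The two representations of z have the coefficients \<open>k * a + 1 \<ge> 1\<close> and \<open>a' \<le> 1\<close> at x;
        their convex combination with the following weights has the coefficient 1.\<close>
      define s where "s = k * a + b'"
      show "z \<in> (*\<^sub>R) k ` R + Q + {x}"
      proof (cases "s = 0")
        case True
        then have "b' = 0" "k * a = 0"
          using k 1 2 by (auto simp: s_def add_nonneg_eq_0_iff)
        then have "z = k *\<^sub>R \<rho>1 + q' + x" using 2 by (simp add: add_ac)
        moreover have "k *\<^sub>R \<rho>1 + q' + x \<in> (*\<^sub>R) k ` R + Q + {x}"
          using 2 by (intro set_plus_intro) auto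
        ultimately show ?thesis by (simp only:)
      next
        case False
        then have s: "s > 0" using k 1 2 by (simp add: s_def add_nonneg_eq_0_iff less_le)
        define p where "p = k * a / s"
        define p' where "p' = b' / s"
        have p: "p \<ge> 0" "p' \<ge> 0" "p + p' = 1"
          using s k 1 2 False by (auto simp: p_def p'_def s_def simp flip: add_divide_distrib)
        have eqx: "p' * (k * a) = p * b'" by (simp add: p_def p'_def)
        define r where "r = (p' * b) *\<^sub>R \<rho> + p *\<^sub>R \<rho>1"
        have "z = p' *\<^sub>R z + p *\<^sub>R z" using p by (simp flip: scaleR_add_left add: add.commute)
        also have "\<dots> = p' *\<^sub>R (k *\<^sub>R (a *\<^sub>R x + b *\<^sub>R \<rho>) + q + x) + p *\<^sub>R (k *\<^sub>R \<rho>1 + ((a' *\<^sub>R x + b' *\<^sub>R \<rho>') + q'))"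
          using 1(1) 2(1) by metis
        also have "\<dots> = (p' * (k * a) + p' + p * a') *\<^sub>R x + ((k * (p' * b)) *\<^sub>R \<rho> + (k * p) *\<^sub>R \<rho>1 + (p * b') *\<^sub>R \<rho>')
             + (p' *\<^sub>R q + p *\<^sub>R q')"
          by (simp add: algebra_simps)
        also have "p' * (k * a) + p' + p * a' = 1"
        proof -
          have "p' * (k * a) + p' + p * a' = p * (a' + b') + p'"
            unfolding eqx by (simp add: algebra_simps)
          then show ?thesis using 2 p by simp
        qed
        finally have z': "z = x + ((k * (p' * b)) *\<^sub>R \<rho> + (k * p) *\<^sub>R \<rho>1 + (p * b') *\<^sub>R \<rho>')
             + (p' *\<^sub>R q + p *\<^sub>R q')" by simp
        have "(k * (p' * b)) *\<^sub>R \<rho> + (k * p) *\<^sub>R \<rho>1 + (p * b') *\<^sub>R \<rho>' \<in> (*\<^sub>R) k ` R"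
        proof (cases "k = 0")
          case True
          then have "p = 0" by (simp add: p_def)
          then show ?thesis using True R by auto
        next
          case False
          then have k: "k > 0" using k by simp
          have "p' * b + p + p * b' / k = 1"
          proof -
            have "p * b' / k = p' * a" using k by (simp flip: eqx)
            then have "p' * b + p + p * b' / k = p' * (a + b) + p" by (simp add: algebra_simps)
            then show ?thesis using 1 p by simp
          qed
          then have "(p' * b) *\<^sub>R \<rho> + p *\<^sub>R \<rho>1 + (p * b' / k) *\<^sub>R \<rho>' \<in> convex hull {\<rho>, \<rho>1, \<rho>'}"
            unfolding convex_hull_3 using p 1 2 k by (intro CollectI exI conjI) auto
          also have "\<dots> \<subseteq> R" using 1 2 R by (intro hull_minimal) auto
          finally have "k *\<^sub>R ((p' * b) *\<^sub>R \<rho> + p *\<^sub>R \<rho>1 + (p * b' / k) *\<^sub>R \<rho>') \<in> (*\<^sub>R) k ` R" by blast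
          then show ?thesis using k by (simp add: scaleR_add_right)
        qed
        moreover have "p' *\<^sub>R q + p *\<^sub>R q' \<in> Q"
          using Q 1 2 p by (intro convexD) auto
        ultimately have "((k * (p' * b)) *\<^sub>R \<rho> + (k * p) *\<^sub>R \<rho>1 + (p * b') *\<^sub>R \<rho>')
             + (p' *\<^sub>R q + p *\<^sub>R q') + x \<in> (*\<^sub>R) k ` R + Q + {x}"
          by (intro set_plus_intro) auto
        then show ?thesis by (simp add: z' add_ac)
      qed
    qed
  qed
qed

section \<open>Polynomial sequences and functions\<close>

text \<open>
  The index \<open>e\<close> is a strict bound for the degree, so that \<open>e = 0\<close> means the zero sequence and every
  difference lowers the index by one. The same convention holds for \<open>lattice_poly\<close> below.
\<close>

definition poly_seq :: "nat \<Rightarrow> (nat \<Rightarrow> real) \<Rightarrow> bool" where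
  "poly_seq e g \<longleftrightarrow> (\<exists>p. (\<forall>i\<ge>e. coeff p i = 0) \<and> (\<forall>k. g k = poly p (real k)))"

lemma poly_seqI: "(\<And>i. i \<ge> e \<Longrightarrow> coeff p i = 0) \<Longrightarrow> (\<And>k. g k = poly p (real k)) \<Longrightarrow> poly_seq e g"
  by (auto simp: poly_seq_def)

lemma poly_seq_add:
  assumes "poly_seq e g" "poly_seq e h"
  shows "poly_seq e (\<lambda>k. g k + h k)"
proof -
  obtain p q where "\<forall>i\<ge>e. coeff p i = 0" "\<forall>k. g k = poly p (real k)"
    "\<forall>i\<ge>e. coeff q i = 0" "\<forall>k. h k = poly q (real k)"
    using assms unfolding poly_seq_def by auto
  then show ?thesis by (intro poly_seqI[where p = "p + q"]) auto
qed

lemma poly_seq_diff: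
  assumes "poly_seq e g" "poly_seq e h"
  shows "poly_seq e (\<lambda>k. g k - h k)"
proof -
  obtain p q where "\<forall>i\<ge>e. coeff p i = 0" "\<forall>k. g k = poly p (real k)"
    "\<forall>i\<ge>e. coeff q i = 0" "\<forall>k. h k = poly q (real k)"
    using assms unfolding poly_seq_def by auto
  then show ?thesis by (intro poly_seqI[where p = "p - q"]) auto
qed

lemma poly_seq_mono: "poly_seq e g \<Longrightarrow> e \<le> e' \<Longrightarrow> poly_seq e' g"
  unfolding poly_seq_def by (meson order_trans)

lemma poly_seq_zero: "poly_seq e (\<lambda>k. 0)"
  by (intro poly_seqI[where p = 0]) auto

lemma poly_eqI_nat:
  fixes p q :: "real poly"
  assumes "\<And>k. poly p (real k) = poly q (real k)"
  shows "p = q"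
proof (rule ccontr)
  assume "p \<noteq> q"
  then have "finite {x. poly (p - q) x = 0}" by (intro poly_roots_finite) simp
  moreover have "range real \<subseteq> {x. poly (p - q) x = 0}" using assms by auto
  ultimately have "finite (range real)" by (rule rev_finite_subset)
  then show False by (simp add: finite_image_iff inj_on_def)
qed

text \<open>The monomials are handled from the top: the difference of \<open>x ^ (e + 1) / (e + 1)\<close> has leading term \<open>x ^ e\<close>.\<close>

lemma poly_antidifference:
  fixes p :: "real poly"
  assumes "\<forall>i\<ge>e. coeff p i = 0"
  shows "\<exists>q. (\<forall>i\<ge>Suc e. coeff q i = 0) \<and> (\<forall>x. poly q (x + 1) - poly q x = poly p x)"
  using assms
proof (induction e arbitrary: p)
  case 0
  then have "p = 0" by (simp add: poly_eq_iff)
  then show ?case by (intro exI[of _ 0]) auto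
next
  case (Suc e)
  define m where "m = monom (coeff p e / real (Suc e)) (Suc e)"
  define d where "d = smult (coeff p e / real (Suc e)) ([:1, 1:] ^ Suc e - monom 1 (Suc e))"
  have d: "poly d x = poly m (x + 1) - poly m x" for x
    by (simp add: d_def m_def poly_monom right_diff_distrib add.commute del: power_Suc)
  have "coeff ([:1, 1:] ^ Suc e :: real poly) i = of_nat (Suc e choose i)" if "i \<le> Suc e" for i
    using that coeff_linear_poly_power[of i "Suc e" "1::real" 1] by simp
  moreover have "coeff ([:1, 1:] ^ Suc e :: real poly) i = 0" if "i > Suc e" for i
    using that by (intro coeff_eq_0) (simp add: degree_linear_power del: power_Suc)
  ultimately have "coeff (p - d) i = 0" if "i \<ge> e" for i
    using that Suc.prems by (cases "i = e"; cases "i = Suc e") (auto simp: d_def simp del: power_Suc)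
  then obtain q where q: "\<forall>i\<ge>Suc e. coeff q i = 0"
      "\<forall>x. poly q (x + 1) - poly q x = poly (p - d) x"
    using Suc.IH by blast
  show ?case
    using q d by (intro exI[of _ "q + m"]) (auto simp: m_def algebra_simps)
qed

lemma poly_seq_from_difference:
  assumes "poly_seq e (\<lambda>k. g (Suc k) - g k)"
  shows "poly_seq (Suc e) g"
proof -
  obtain p where p: "\<forall>i\<ge>e. coeff p i = 0" "\<And>k. g (Suc k) - g k = poly p (real k)"
    using assms by (auto simp: poly_seq_def)
  obtain q where q: "\<forall>i\<ge>Suc e. coeff q i = 0" "\<And>x. poly q (x + 1) - poly q x = poly p x"
    using poly_antidifference[OF p(1)] by blast
  have "g k = poly (q + [:g 0 - poly q 0:]) (real k)" for k
  proof (induction k)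
    case (Suc k)
    then show ?case using p(2)[of k] q(2)[of "real k"] by (simp add: add.commute)
  qed simp
  moreover have "coeff (q + [:g 0 - poly q 0:]) i = 0" if "i \<ge> Suc e" for i
    using that q(1) by (cases i) auto
  ultimately show ?thesis by (intro poly_seqI)
qed

text \<open>
  A sequence that is known to be polynomial, with whatever degree, has the degree of any of its
  arithmetic subsequences.
\<close>

lemma poly_seq_unscale:
  assumes "m > 0" "poly_seq e g" "poly_seq e' (\<lambda>k. g (m * k))"
  shows "poly_seq e' g"
proof -
  obtain p where p: "\<And>k. g k = poly p (real k)"
    using assms(2) by (auto simp: poly_seq_def)
  obtain q where q: "\<forall>i\<ge>e'. coeff q i = 0" "\<And>k. g (m * k) = poly q (real k)"
    using assms(3) by (auto simp: poly_seq_def)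
  have "q = pcompose p [:0, real m:]"
    using p q by (intro poly_eqI_nat) (simp add: poly_pcompose mult.commute)
  then have pq: "p = pcompose q [:0, 1 / real m:]"
    using assms(1) by (intro poly_ext) (simp add: poly_pcompose)
  then have "degree p = degree q"
    using assms(1) by (simp add: degree_pcompose)
  have "coeff p i = 0" if "i \<ge> e'" for i
  proof (cases "q = 0")
    case True
    then show ?thesis by (simp add: pq)
  next
    case False
    then have "degree q < e'"
      using q(1) leading_coeff_0_iff not_le by blast
    then show ?thesis
      using that \<open>degree p = degree q\<close> by (intro coeff_eq_0) simp
  qed
  then show ?thesis using p by (intro poly_seqI)
qed

text \<open>
  The matrix \<open>c\<close> is the inverse of the Vandermonde matrix at the nodes \<open>0, \<dots>, N\<close>; its entries are the
  coefficients of the Lagrange basis polynomials. It expresses homogeneous components as fixed linear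
  combinations of dilates, which inherit all linear properties of the functional.
\<close>

lemma poly_interpolation:
  "\<exists>c :: nat \<Rightarrow> nat \<Rightarrow> real. \<forall>a. \<forall>i\<le>N. (\<Sum>k\<le>N. c i k * (\<Sum>j\<le>N. a j * real k ^ j)) = a i"
proof -
  define B :: "nat \<Rightarrow> real poly" where "B = (\<lambda>k. \<Prod>m\<in>{..N} - {k}. [:- real m, 1:])"
  define L where "L = (\<lambda>k. smult (1 / poly (B k) (real k)) (B k))"
  have degL: "degree (L k) \<le> N" if "k \<le> N" for k
  proof -
    have "degree (B k) \<le> (\<Sum>m\<in>{..N} - {k}. degree [:- real m, 1:])"
      unfolding B_def using degree_prod_sum_le[of "{..N} - {k}" "\<lambda>m. [:- real m, 1:]"] by (simp add: o_def)
    also have "\<dots> = N" using that by simp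
    finally show ?thesis unfolding L_def using degree_smult_le order_trans by blast
  qed
  have evalL: "poly (L k) (real l) = (if k = l then 1 else 0)" if "k \<le> N" "l \<le> N" for k l
  proof -
    have "poly (B k) (real l) \<noteq> 0 \<longleftrightarrow> k = l"
      using that by (auto simp: B_def poly_prod)
    then show ?thesis by (auto simp: L_def)
  qed
  have "(\<Sum>k\<le>N. coeff (L k) i * (\<Sum>j\<le>N. a j * real k ^ j)) = a i" if "i \<le> N" for a i
  proof -
    define p where "p = (\<Sum>j\<le>N. monom (a j) j)"
    define q where "q = (\<Sum>k\<le>N. smult (poly p (real k)) (L k))"
    have "degree p \<le> N" unfolding p_def
      by (intro degree_sum_le) (auto intro: order_trans[OF degree_monom_le])
    moreover have "degree q \<le> N" unfolding q_def
      by (intro degree_sum_le) (auto intro: order_trans[OF degree_smult_le] degL)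
    moreover have "poly q (real l) = poly p (real l)" if "l \<le> N" for l
    proof -
      have "poly q (real l) = (\<Sum>k\<le>N. if k = l then poly p (real l) else 0)"
        unfolding q_def poly_sum using that by (intro sum.cong) (auto simp: evalL)
      then show ?thesis using that by simp
    qed
    ultimately have "q = p"
      by (intro poly_eqI_degree[where A = "real ` {..N}"]) (auto simp: card_image)
    moreover have "coeff q i = (\<Sum>k\<le>N. coeff (L k) i * (\<Sum>j\<le>N. a j * real k ^ j))"
      by (simp add: q_def p_def coeff_sum poly_sum poly_monom mult.commute)
    moreover have "coeff p i = a i"
      using that by (simp add: p_def coeff_sum)
    ultimately show ?thesis by simp
  qed
  then show ?thesis by (intro exI[of _ "\<lambda>i k. coeff (L k) i"]) blast
qed

text \<open>
  Polynomials of degree less than \<open>d\<close> on the integer lattice, encoded by the vanishing of all differences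
  of order \<open>d\<close>. No coordinates or coefficients are chosen, and passing to a difference of a
  translation covariant functional lowers \<open>d\<close> by definition.
\<close>

primrec lattice_poly :: "nat \<Rightarrow> (real ^ 'n \<Rightarrow> real) \<Rightarrow> bool" where
  "lattice_poly 0 \<phi> \<longleftrightarrow> (\<forall>x\<in>integer_lattice. \<phi> x = 0)"
| "lattice_poly (Suc d) \<phi> \<longleftrightarrow> (\<forall>y\<in>integer_lattice. lattice_poly d (\<lambda>x. \<phi> (x + y) - \<phi> x))"

lemma lattice_poly_cong:
  "(\<And>x. x \<in> integer_lattice \<Longrightarrow> \<phi> x = \<psi> x) \<Longrightarrow> lattice_poly d \<phi> \<longleftrightarrow> lattice_poly d \<psi>"
proof (induction d arbitrary: \<phi> \<psi>)
  case (Suc d)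
  have "lattice_poly d (\<lambda>x. \<phi> (x + y) - \<phi> x) \<longleftrightarrow> lattice_poly d (\<lambda>x. \<psi> (x + y) - \<psi> x)"
    if "y \<in> integer_lattice" for y
    using that by (intro Suc.IH) (simp add: Suc.prems integer_lattice_add)
  then show ?case by simp
qed simp

lemma lattice_poly_zero: "lattice_poly d (\<lambda>x. 0)"
  by (induction d) auto

lemma lattice_poly_Suc: "lattice_poly d \<phi> \<Longrightarrow> lattice_poly (Suc d) \<phi>"
proof (induction d arbitrary: \<phi>)
  case 0
  then show ?case by (auto intro: integer_lattice_add)
next
  case (Suc d)
  show ?case
    unfolding lattice_poly.simps(2)[of "Suc d"] using Suc by auto
qed

lemma lattice_poly_mono: "d \<le> e \<Longrightarrow> lattice_poly d \<phi> \<Longrightarrow> lattice_poly e \<phi>"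
  by (induction rule: dec_induct) (auto intro: lattice_poly_Suc simp del: lattice_poly.simps)

lemma lattice_poly_add:
  "lattice_poly d \<phi> \<Longrightarrow> lattice_poly d \<psi> \<Longrightarrow> lattice_poly d (\<lambda>x. \<phi> x + \<psi> x)"
proof (induction d arbitrary: \<phi> \<psi>)
  case (Suc d)
  have "lattice_poly d (\<lambda>x. (\<phi> (x + y) - \<phi> x) + (\<psi> (x + y) - \<psi> x))" if "y \<in> integer_lattice" for y
    using Suc that by auto
  then show ?case by (simp add: algebra_simps)
qed auto

lemma lattice_poly_cmult: "lattice_poly d \<phi> \<Longrightarrow> lattice_poly d (\<lambda>x. c * \<phi> x)"
proof (induction d arbitrary: \<phi>)
  case (Suc d)
  then have "lattice_poly d (\<lambda>x. c * (\<phi> (x + y) - \<phi> x))" if "y \<in> integer_lattice" for y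
    using that by auto
  then show ?case by (simp add: algebra_simps)
qed auto

lemma lattice_poly_sum:
  "(\<And>i. i \<in> A \<Longrightarrow> lattice_poly d (\<phi> i)) \<Longrightarrow> lattice_poly d (\<lambda>x. \<Sum>i\<in>A. \<phi> i x)"
  by (induction A rule: infinite_finite_induct) (auto intro: lattice_poly_zero lattice_poly_add simp del: lattice_poly.simps)

lemma lattice_poly_translate:
  "y \<in> integer_lattice \<Longrightarrow> lattice_poly d \<phi> \<Longrightarrow> lattice_poly d (\<lambda>x. \<phi> (x + y))"
proof (induction d arbitrary: \<phi>)
  case 0
  then show ?case by (auto intro: integer_lattice_add)
next
  case (Suc d)
  have "lattice_poly d (\<lambda>x. \<phi> (x + y + z) - \<phi> (x + y))" if "z \<in> integer_lattice" for z
    using Suc.IH[of "\<lambda>x. \<phi> (x + z) - \<phi> x"] Suc.prems that by auto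
  then show ?case by (simp add: add_ac)
qed

lemma lattice_poly_mult_inner:
  "lattice_poly d \<phi> \<Longrightarrow> lattice_poly (Suc d) (\<lambda>x. \<phi> x * (x \<bullet> w))"
proof (induction d arbitrary: \<phi>)
  case 0
  then show ?case by (auto intro: integer_lattice_add)
next
  case (Suc d)
  have "lattice_poly (Suc d) (\<lambda>x. (\<phi> (x + y) - \<phi> x) * (x \<bullet> w) + (y \<bullet> w) * \<phi> (x + y))"
    if "y \<in> integer_lattice" for y
  proof (rule lattice_poly_add)
    show "lattice_poly (Suc d) (\<lambda>x. (\<phi> (x + y) - \<phi> x) * (x \<bullet> w))"
      using Suc that by auto
    show "lattice_poly (Suc d) (\<lambda>x. (y \<bullet> w) * \<phi> (x + y))"
      using Suc.prems that by (intro lattice_poly_cmult lattice_poly_translate)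
  qed
  then show ?case
    unfolding lattice_poly.simps(2)[of "Suc d"] by (simp add: algebra_simps inner_add_left)
qed

lemma lattice_poly_prod_inner: "lattice_poly (Suc j) (\<lambda>x. \<Prod>i<j. x \<bullet> w i)"
proof (induction j)
  case 0
  then show ?case by simp
next
  case (Suc j)
  then show ?case using lattice_poly_mult_inner[OF Suc] by (simp del: lattice_poly.simps)
qed

section \<open>Polynomiality on dilates\<close>

text \<open>
  The additivity of a scalar component of a tensor valuation, which is inherited by translation
  differences.
\<close>

definition weak_valuation :: "((real ^ 'n) set \<Rightarrow> real) \<Rightarrow> bool" where
  "weak_valuation f \<longleftrightarrow> (\<forall>P Q. P \<in> lattice_polytopes \<and> Q \<in> lattice_polytopes \<and>
     P \<union> Q \<in> lattice_polytopes \<and> P \<inter> Q \<in> lattice_polytopes \<longrightarrow> f P + f Q = f (P \<union> Q) + f (P \<inter> Q))"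

definition translation_poly :: "nat \<Rightarrow> ((real ^ 'n) set \<Rightarrow> real) \<Rightarrow> bool" where
  "translation_poly d f \<longleftrightarrow> (\<forall>P\<in>lattice_polytopes. lattice_poly d (\<lambda>y. f (P + {y})))"

lemma weak_valuationD:
  assumes "weak_valuation f" "P \<in> lattice_polytopes" "Q \<in> lattice_polytopes"
    "P \<union> Q \<in> lattice_polytopes" "P \<inter> Q \<in> lattice_polytopes"
  shows "f (P \<union> Q) = f P + f Q - f (P \<inter> Q)"
  using assms unfolding weak_valuation_def by (simp add: eq_diff_eq)

lemma weak_valuation_translation_difference:
  assumes f: "weak_valuation f" and y: "y \<in> integer_lattice"
  shows "weak_valuation (\<lambda>P. f (P + {y}) - f P)"
  unfolding weak_valuation_def
proof (intro allI impI, elim conjE)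
  fix P Q :: "(real ^ 'a) set"
  assume L: "P \<in> lattice_polytopes" "Q \<in> lattice_polytopes"
    "P \<union> Q \<in> lattice_polytopes" "P \<inter> Q \<in> lattice_polytopes"
  have eq: "(P \<union> Q) + {y} = (P + {y}) \<union> (Q + {y})" "(P \<inter> Q) + {y} = (P + {y}) \<inter> (Q + {y})"
    by (auto simp: set_plus_def)
  have "f ((P \<union> Q) + {y}) = f (P + {y}) + f (Q + {y}) - f ((P \<inter> Q) + {y})"
    unfolding eq using L y
    by (intro weak_valuationD[OF f]) (auto simp flip: eq simp: lattice_polytopes_plus lattice_polytopes_singleton)
  moreover have "f (P \<union> Q) = f P + f Q - f (P \<inter> Q)"
    by (intro weak_valuationD[OF f] L)
  ultimately show "f (P + {y}) - f P + (f (Q + {y}) - f Q) =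
      f (P \<union> Q + {y}) - f (P \<union> Q) + (f (P \<inter> Q + {y}) - f (P \<inter> Q))"
    by simp
qed

lemma translation_poly_difference:
  assumes "translation_poly (Suc d) f" and y: "y \<in> integer_lattice"
  shows "translation_poly d (\<lambda>P. f (P + {y}) - f P)"
proof -
  have "P + {x} + {y} = P + {x + y}" for P :: "(real ^ 'a) set" and x
    by (simp add: add.assoc) (simp add: set_plus_def)
  then show ?thesis using assms by (auto simp: translation_poly_def)
qed

text \<open>
  For a cone \<open>S\<close> with apex \<open>x\<close> over \<open>R\<close>, the slicing of \<open>(k + 1) S + Q\<close> shows that
  \<open>f ((k + 1) S + Q) - f (k S + Q)\<close> is the sum of the translation difference
  \<open>f (k S + Q + x) - f (k S + Q)\<close>, which has smaller \<open>d\<close>, and of a difference of two terms that dilate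
  \<open>R\<close> in place of \<open>S\<close>, which has one vertex fewer. Since \<open>V\<close> may be affinely dependent, every lattice polytope is covered;
  the price is that the degree depends on the number of vertices instead of the dimension.
\<close>

theorem poly_seq_dilate_plus:
  assumes "weak_valuation f" "translation_poly d f"
    and "finite V" "V \<noteq> {}" "V \<subseteq> integer_lattice" "Q \<in> lattice_polytopes"
  shows "poly_seq (card V - 1 + d) (\<lambda>k. f ((*\<^sub>R) (real k) ` (convex hull V) + Q))"
  using assms
proof (induction d arbitrary: f V Q)
  case 0
  have "f P = 0" if "P \<in> lattice_polytopes" for P
  proof -
    have "f (P + {0}) = 0"
      using 0(2) that integer_lattice_0 unfolding translation_poly_def lattice_poly.simps by blast
    then show ?thesis by simp
  qed
  moreover have "(*\<^sub>R) (real k) ` (convex hull V) + Q \<in> lattice_polytopes" for k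
    using 0 by (intro lattice_polytopes_plus lattice_polytopes_scale hull_in_lattice_polytopes) auto
  ultimately show ?case by (simp add: poly_seq_zero)
next
  case (Suc d)
  from Suc.prems(3-6) show ?case
  proof (induction V arbitrary: Q rule: finite_ne_induct)
    case (singleton x)
    have step: "(*\<^sub>R) (real k) ` (convex hull {x}) + Q + {x} = (*\<^sub>R) (real (Suc k)) ` (convex hull {x}) + Q" for k
    proof -
      have eq: "{real (Suc k) *\<^sub>R x} = {real k *\<^sub>R x} + {x}"
        by (simp add: set_plus_def algebra_simps)
      have "{real (Suc k) *\<^sub>R x} + Q = {real k *\<^sub>R x} + Q + {x}"
        unfolding eq by (simp only: add_ac)
      then show ?thesis by simp
    qed
    have "poly_seq d (\<lambda>k. f ((*\<^sub>R) (real k) ` (convex hull {x}) + Q + {x}) -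
        f ((*\<^sub>R) (real k) ` (convex hull {x}) + Q))"
      using Suc.IH[OF weak_valuation_translation_difference[OF Suc.prems(1), of x]
          translation_poly_difference[OF Suc.prems(2), of x], of "{x}" Q] singleton by simp
    then have "poly_seq (Suc d) (\<lambda>k. f ((*\<^sub>R) (real k) ` (convex hull {x}) + Q))"
      unfolding step by (rule poly_seq_from_difference)
    then show ?case by simp
  next
    case (insert x V)
    define R where "R = convex hull V"
    define S where "S = convex hull (insert x V)"
    have S: "S = convex hull (insert x R)"
      unfolding S_def R_def by (rule hull_insert)
    have x: "x \<in> integer_lattice" and V: "V \<subseteq> integer_lattice" using insert by auto
    have L: "R \<in> lattice_polytopes" "S \<in> lattice_polytopes" "Q \<in> lattice_polytopes" "{x} \<in> lattice_polytopes"
      using insert x V by (auto simp: R_def S_def intro!: hull_in_lattice_polytopes lattice_polytopes_singleton)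
    have R: "convex R" "R \<noteq> {}" "convex Q"
      using insert by (auto simp: R_def lattice_polytope_convex)
    have card: "card (insert x V) - 1 + d = card V - 1 + Suc d"
      using insert by (cases "card V") auto
    have step: "f ((*\<^sub>R) (real (Suc k)) ` S + Q) - f ((*\<^sub>R) (real k) ` S + Q) =
        (f ((*\<^sub>R) (real k) ` S + Q + {x}) - f ((*\<^sub>R) (real k) ` S + Q)) +
        (f ((*\<^sub>R) (real k) ` R + (S + Q)) - f ((*\<^sub>R) (real k) ` R + (Q + {x})))" for k
    proof -
      note slice = cone_slice[OF R S, of "real k"]
      have "f ((*\<^sub>R) (real k + 1) ` S + Q) = f ((*\<^sub>R) (real k) ` S + Q + {x}) +
          f ((*\<^sub>R) (real k) ` R + (S + Q)) - f ((*\<^sub>R) (real k) ` R + Q + {x})"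
        unfolding slice(1)[OF of_nat_0_le_iff] slice(2)[OF of_nat_0_le_iff, symmetric]
        by (intro weak_valuationD[OF Suc.prems(1)])
          (auto simp: slice(2) slice(1)[symmetric] intro!: lattice_polytopes_plus lattice_polytopes_scale L)
      then show ?thesis by (simp add: add_ac)
    qed
    have "poly_seq (card (insert x V) - 1 + d)
        (\<lambda>k. f ((*\<^sub>R) (real k) ` S + Q + {x}) - f ((*\<^sub>R) (real k) ` S + Q))"
      unfolding S_def
      using Suc.IH[OF weak_valuation_translation_difference[OF Suc.prems(1) x]
          translation_poly_difference[OF Suc.prems(2) x], of "insert x V" Q] insert by simp
    moreover have "poly_seq (card (insert x V) - 1 + d)
        (\<lambda>k. f ((*\<^sub>R) (real k) ` R + (S + Q)) - f ((*\<^sub>R) (real k) ` R + (Q + {x})))"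
      unfolding card R_def
      by (intro poly_seq_diff insert.IH V lattice_polytopes_plus L)
    ultimately have "poly_seq (Suc (card (insert x V) - 1 + d)) (\<lambda>k. f ((*\<^sub>R) (real k) ` S + Q))"
      by (intro poly_seq_from_difference) (simp only: step poly_seq_add)
    then show ?case by (simp add: S_def)
  qed
qed

section \<open>The degree bound\<close>

text \<open>
  Gaussian elimination without division: one unknown is eliminated with the help of one equation.
\<close>

lemma integer_system_nontrivial_solution:
  fixes a :: "'j \<Rightarrow> 'i \<Rightarrow> int"
  assumes "finite J" "finite I" "card J < card I"
  shows "\<exists>c. (\<exists>i\<in>I. c i \<noteq> 0) \<and> (\<forall>j\<in>J. (\<Sum>i\<in>I. a j i * c i) = 0)"
  using assms
proof (induction J arbitrary: I a rule: finite_induct)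
  case empty
  then show ?case by (intro exI[of _ "\<lambda>_. 1"]) (auto simp: card_gt_0_iff)
next
  case (insert j J)
  show ?case
  proof (cases "\<forall>i\<in>I. a j i = 0")
    case True
    then show ?thesis using insert.IH[of I a] insert by auto
  next
    case False
    then obtain p where p: "p \<in> I" "a j p \<noteq> 0" by auto
    define I' where "I' = I - {p}"
    have I: "I = insert p I'" "p \<notin> I'" "finite I'" using p insert by (auto simp: I'_def)
    have "card J < card I'" using insert p by (simp add: I'_def)
    then obtain c where c: "\<exists>i\<in>I'. c i \<noteq> 0"
        "\<forall>m\<in>J. (\<Sum>i\<in>I'. (a m i * a j p - a m p * a j i) * c i) = 0"
      using insert.IH[of I' "\<lambda>m i. a m i * a j p - a m p * a j i"] I by blast
    define c' where "c' i = (if i = p then - (\<Sum>i\<in>I'. a j i * c i) else a j p * c i)" for i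
    have sum: "(\<Sum>i\<in>I. a m i * c' i) = (\<Sum>i\<in>I'. (a m i * a j p - a m p * a j i) * c i)" for m
    proof -
      have "(\<Sum>i\<in>I'. a m i * c' i) = (\<Sum>i\<in>I'. a m i * (a j p * c i))"
        using I by (intro sum.cong) (auto simp: c'_def)
      then show ?thesis
        using I by (simp add: c'_def sum_distrib_left algebra_simps sum_subtractf)
    qed
    have "\<exists>i\<in>I. c' i \<noteq> 0" using c(1) p I by (auto simp: c'_def)
    moreover have "(\<Sum>i\<in>I. a m i * c' i) = 0" if "m \<in> insert j J" for m
      using that c(2) by (auto simp: sum)
    ultimately show ?thesis by blast
  qed
qed

text \<open>
  One equation per coordinate, and one more that makes the coefficients add up to zero.
\<close>

lemma integer_affine_dependence:
  fixes h :: "'i \<Rightarrow> real ^ 'n"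
  assumes "finite I" "card I \<ge> CARD('n) + 2" "h ` I \<subseteq> integer_lattice"
  obtains c :: "'i \<Rightarrow> int" where "\<exists>i\<in>I. c i \<noteq> 0" "(\<Sum>i\<in>I. c i) = 0"
    "(\<Sum>i\<in>I. real_of_int (c i) *\<^sub>R h i) = 0"
proof -
  define a :: "'n option \<Rightarrow> 'i \<Rightarrow> int" where
    "a = (\<lambda>j i. case j of None \<Rightarrow> 1 | Some m \<Rightarrow> \<lfloor>h i $ m\<rfloor>)"
  have "card (UNIV :: 'n option set) < card I"
    using assms(2) by (simp add: card_UNIV_option)
  then obtain c where c: "\<exists>i\<in>I. c i \<noteq> 0" "\<And>j. (\<Sum>i\<in>I. a j i * c i) = 0"
    using integer_system_nontrivial_solution[of UNIV I a] assms(1) by auto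
  have "(\<Sum>i\<in>I. real_of_int (c i) *\<^sub>R h i) $ m = 0" for m
  proof -
    have "(\<Sum>i\<in>I. real_of_int (c i) *\<^sub>R h i) $ m = (\<Sum>i\<in>I. real_of_int (a (Some m) i * c i))"
      unfolding sum_component
    proof (intro sum.cong refl)
      fix i assume "i \<in> I"
      then have "h i $ m \<in> \<int>" using assms(3) by (auto simp: integer_lattice_def)
      then show "(real_of_int (c i) *\<^sub>R h i) $ m = real_of_int (a (Some m) i * c i)"
        by (auto simp: a_def elim!: Ints_cases)
    qed
    also have "\<dots> = real_of_int (\<Sum>i\<in>I. a (Some m) i * c i)" by simp
    also have "\<dots> = 0" by (simp only: c(2) of_int_0)
    finally show ?thesis .
  qed
  then have "(\<Sum>i\<in>I. real_of_int (c i) *\<^sub>R h i) = 0" by (simp add: vec_eq_iff)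
  then show ?thesis using that[of c] c(1) c(2)[of None] by (simp add: a_def)
qed

lemma convex_hull_drop_dependent_point:
  fixes h :: "'i \<Rightarrow> 'a::real_vector" and c :: "'i \<Rightarrow> real"
  assumes "finite I" "a \<in> I" "c a > 0" "\<And>i. i \<in> I - {a} \<Longrightarrow> c i \<le> 0"
    "(\<Sum>i\<in>I. c i) = 0" "(\<Sum>i\<in>I. c i *\<^sub>R h i) = 0"
  shows "convex hull (h ` I) = convex hull (h ` (I - {a}))"
proof -
  define w where "w i = - c i / c a" for i
  have "(\<Sum>i\<in>I - {a}. c i) = - c a" "(\<Sum>i\<in>I - {a}. c i *\<^sub>R h i) = - c a *\<^sub>R h a"
    using assms by (simp_all add: sum_diff1)
  moreover have "(\<Sum>i\<in>I - {a}. w i *\<^sub>R h i) = (- 1 / c a) *\<^sub>R (\<Sum>i\<in>I - {a}. c i *\<^sub>R h i)"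
    by (simp add: w_def scaleR_sum_right sum_negf)
  ultimately have "(\<Sum>i\<in>I - {a}. w i) = 1" and sum: "(\<Sum>i\<in>I - {a}. w i *\<^sub>R h i) = h a"
    using assms(3) by (simp_all add: w_def sum_negf flip: sum_divide_distrib)
  then have "(\<Sum>i\<in>I - {a}. w i *\<^sub>R h i) \<in> convex hull (h ` (I - {a}))"
    using assms by (intro convex_sum) (auto simp: w_def divide_nonpos_pos intro: hull_inc)
  then have "convex hull (insert (h a) (h ` (I - {a}))) = convex hull (h ` (I - {a}))"
    by (simp add: sum hull_redundant)
  moreover have "h ` I = insert (h a) (h ` (I - {a}))" using assms(2) by auto
  ultimately show ?thesis by simp
qed

lemma dilate_hull: "(*\<^sub>R) k ` (convex hull S) = convex hull ((*\<^sub>R) k ` S)"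
  using convex_hull_scaling[of k S] by simp

text \<open>
  The cut through \<open>u\<close> is compatible with dilation, so the three remaining hulls determine the values of \<open>f\<close>
  on the dilates of the fourth.
\<close>

lemma poly_seq_split_edge:
  fixes f :: "(real ^ 'n) set \<Rightarrow> real"
  assumes f: "weak_valuation f"
    and W: "finite W" "W \<subseteq> integer_lattice" and xyu: "x \<in> integer_lattice" "y \<in> integer_lattice" "u \<in> integer_lattice"
    and t: "0 \<le> t" "t \<le> 1" and u: "u = (1 - t) *\<^sub>R x + t *\<^sub>R y"
    and "poly_seq e (\<lambda>k. f ((*\<^sub>R) (real k) ` (convex hull (insert x (insert u W)))))"
    and "poly_seq e (\<lambda>k. f ((*\<^sub>R) (real k) ` (convex hull (insert y (insert u W)))))"
    and "poly_seq e (\<lambda>k. f ((*\<^sub>R) (real k) ` (convex hull (insert u W))))"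
  shows "poly_seq e (\<lambda>k. f ((*\<^sub>R) (real k) ` (convex hull (insert x (insert y W)))))"
proof -
  define C where "C = convex hull (insert u W)"
  have hulls: "convex hull (insert x C) = convex hull (insert x (insert u W))"
    "convex hull (insert y C) = convex hull (insert y (insert u W))"
    unfolding C_def by (simp_all flip: hull_insert)
  have hull: "convex hull (insert x (insert y C)) = convex hull (insert x (insert y W))"
  proof -
    have "u \<in> convex hull (insert x (insert y W))"
      using t unfolding u by (intro convexD[OF convex_convex_hull] hull_inc) auto
    then have "convex hull (insert u (insert x (insert y W))) = convex hull (insert x (insert y W))"
      by (rule hull_redundant)
    moreover have "convex hull (insert x (insert y C)) = convex hull (insert x (insert y (insert u W)))"
      by (metis hull_insert hulls(2))
    ultimately show ?thesis by (simp add: insert_commute)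
  qed
  have "f ((*\<^sub>R) (real k) ` (convex hull (insert x (insert y C)))) =
     f ((*\<^sub>R) (real k) ` (convex hull (insert x C))) + f ((*\<^sub>R) (real k) ` (convex hull (insert y C)))
     - f ((*\<^sub>R) (real k) ` C)" for k
  proof -
    define C' where "C' = (*\<^sub>R) (real k) ` C"
    define x' where "x' = real k *\<^sub>R x"
    define y' where "y' = real k *\<^sub>R y"
    have C': "convex C'" unfolding C'_def C_def by (intro convex_scaling) simp
    have u': "real k *\<^sub>R u \<in> C'" by (auto simp: C'_def C_def intro: hull_inc)
    have ut': "real k *\<^sub>R u = (1 - t) *\<^sub>R x' + t *\<^sub>R y'"
      by (simp add: u x'_def y'_def algebra_simps)
    note seg = segment_through_convex[OF C' u' t ut']
    have L: "C' \<in> lattice_polytopes" "convex hull (insert x' C') \<in> lattice_polytopes"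
        "convex hull (insert y' C') \<in> lattice_polytopes" "convex hull (insert x' (insert y' C')) \<in> lattice_polytopes"
    proof -
      have L0: "C \<in> lattice_polytopes" "convex hull (insert x C) \<in> lattice_polytopes"
        "convex hull (insert y C) \<in> lattice_polytopes" "convex hull (insert x (insert y C)) \<in> lattice_polytopes"
        unfolding hulls hull using W xyu by (auto simp: C_def intro!: hull_in_lattice_polytopes)
      show "C' \<in> lattice_polytopes" "convex hull (insert x' C') \<in> lattice_polytopes"
        "convex hull (insert y' C') \<in> lattice_polytopes" "convex hull (insert x' (insert y' C')) \<in> lattice_polytopes"
        using L0[THEN lattice_polytopes_scale, of "real k"] by (auto simp: C'_def x'_def y'_def dilate_hull)
    qed
    have "f (convex hull (insert x' (insert y' C'))) = f (convex hull (insert x' C')) + f (convex hull (insert y' C')) - f C'"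
      using weak_valuationD[OF f L(2) L(3)] L(1,4) by (simp only: seg)
    then show ?thesis by (simp only: C'_def x'_def y'_def dilate_hull image_insert)
  qed
  then show ?thesis
    using poly_seq_diff[OF poly_seq_add[OF assms(10,11)] assms(12)]
    by (simp only: hull hulls) (simp only: C_def)
qed

text \<open>
  Points are removed from an affinely dependent family by induction on the number of positive
  coefficients of the dependence \<open>c\<close>. With a single positive coefficient, its point lies in the hull of the
  others. Otherwise the two points \<open>a\<close>, \<open>b\<close> with positive coefficients span an edge, which is cut at the
  point dividing it in the ratio of the coefficients. In each half, this point replaces one
  end of the edge and takes over the sum of the coefficients, so the other end gets the
  coefficient 0 and drops out of the dependence; the intersection of the halves has fewer points.
  The cut point is rational in general. It becomes a lattice point after the dilation by \<open>M\<close>, which is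
  harmless since the degree of a polynomial sequence can be read off at multiples of \<open>M\<close>. This is
  why polynomiality has to be known before the bound for its degree.
\<close>

lemma poly_seq_dependent_hull:
  fixes f :: "(real ^ 'n) set \<Rightarrow> real" and I :: "nat set"
  assumes f: "weak_valuation f"
    and poly: "\<And>P. P \<in> lattice_polytopes \<Longrightarrow> \<exists>e. poly_seq e (\<lambda>k. f ((*\<^sub>R) (real k) ` P))"
    and fewer: "\<And>J h. finite J \<Longrightarrow> card J < card I \<Longrightarrow> h ` J \<subseteq> integer_lattice \<Longrightarrow>
      poly_seq e (\<lambda>k. f ((*\<^sub>R) (real k) ` (convex hull (h ` (J :: nat set)))))"
    and I: "finite I" and h: "h ` I \<subseteq> integer_lattice"
    and c: "card {i\<in>I. c i > 0} = Suc p" "(\<Sum>i\<in>I. c i) = (0::int)"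
      "(\<Sum>i\<in>I. real_of_int (c i) *\<^sub>R h i) = 0"
  shows "poly_seq e (\<lambda>k. f ((*\<^sub>R) (real k) ` (convex hull (h ` I))))"
  using h c
proof (induction p arbitrary: h c)
  case 0
  then obtain a where a: "{i\<in>I. c i > 0} = {a}"
    by (metis One_nat_def card_1_singletonE)
  have "convex hull (h ` I) = convex hull (h ` (I - {a}))"
  proof (rule convex_hull_drop_dependent_point[where c = "\<lambda>i. real_of_int (c i)"])
    show "real_of_int (c i) \<le> 0" if "i \<in> I - {a}" for i
      using a that by force
    show "(\<Sum>i\<in>I. real_of_int (c i)) = 0" using 0 by (simp flip: of_int_sum)
  qed (use I a 0 in auto)
  moreover have "card (I - {a}) < card I" using I a by (intro psubset_card_mono) auto
  ultimately show ?case
    using fewer[of "I - {a}" h] I 0 by auto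
next
  case (Suc p)
  have "{i\<in>I. c i > 0} \<noteq> {}" using Suc.prems(2) by (metis card.empty nat.simps(3))
  then obtain a where a: "a \<in> I" "c a > 0" by blast
  have "card ({i\<in>I. c i > 0} - {a}) = Suc p" using Suc.prems(2) a I by simp
  then have "{i\<in>I. c i > 0} - {a} \<noteq> {}" by (metis card.empty nat.simps(3))
  then obtain b where b: "b \<in> I" "c b > 0" "b \<noteq> a" by blast
  \<comment> \<open>\<open>M\<close> is the denominator of the weights with which \<open>h a\<close> and \<open>h b\<close> enter the cut point.\<close>
  define M where "M = c a + c b"
  have M: "M > 0" using a b by (simp add: M_def)
  define g where "g = (\<lambda>i. real_of_int M *\<^sub>R h i)"
  define u where "u = real_of_int (c a) *\<^sub>R h a + real_of_int (c b) *\<^sub>R h b"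
  define W where "W = g ` (I - {a, b})"
  define t where "t = real_of_int (c b) / real_of_int M"
  have hL: "h i \<in> integer_lattice" if "i \<in> I" for i using that Suc.prems(1) by auto
  have gL: "g i \<in> integer_lattice" if "i \<in> I" for i
    unfolding g_def using that by (intro integer_lattice_scale hL) auto
  have uL: "u \<in> integer_lattice"
    unfolding u_def using a b by (intro integer_lattice_add integer_lattice_scale hL) auto
  have sumg: "(\<Sum>i\<in>I. real_of_int (c i) *\<^sub>R g i) = 0"
  proof -
    have "(\<Sum>i\<in>I. real_of_int (c i) *\<^sub>R g i) = real_of_int M *\<^sub>R (\<Sum>i\<in>I. real_of_int (c i) *\<^sub>R h i)"
      by (simp add: g_def scaleR_sum_right mult.commute)
    then show ?thesis using Suc.prems(4) by simp
  qed
  have ug: "real_of_int M *\<^sub>R u = real_of_int (c a) *\<^sub>R g a + real_of_int (c b) *\<^sub>R g b"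
    by (simp add: u_def g_def algebra_simps)
  have half: "poly_seq e (\<lambda>k. f ((*\<^sub>R) (real k) ` (convex hull (insert (g s) (insert u W)))))"
    if rs: "r \<in> I" "s \<in> I" "r \<noteq> s" "c r > 0" "c s > 0" "M = c r + c s" "W = g ` (I - {r, s})"
      "real_of_int M *\<^sub>R u = real_of_int (c r) *\<^sub>R g r + real_of_int (c s) *\<^sub>R g s" for r s
  proof -
    have I': "I = insert r (insert s (I - {r, s}))" using rs by auto
    have "poly_seq e (\<lambda>k. f ((*\<^sub>R) (real k) ` (convex hull ((g(r := u)) ` I))))"
    proof (rule Suc.IH[where c = "c(r := M, s := 0)"])
      show "(g(r := u)) ` I \<subseteq> integer_lattice" using gL uL by auto
      have "{i \<in> I. (c(r := M, s := 0)) i > 0} = {i\<in>I. c i > 0} - {s}"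
        using rs M by auto
      then show "card {i \<in> I. (c(r := M, s := 0)) i > 0} = Suc p"
        using Suc.prems(2) rs I by simp
      have rest: "(\<Sum>i\<in>I - {r, s}. (c(r := M, s := 0)) i) = (\<Sum>i\<in>I - {r, s}. c i)"
        by (intro sum.cong) auto
      have "(\<Sum>i\<in>I. d i) = d r + d s + (\<Sum>i\<in>I - {r, s}. d i)" for d :: "nat \<Rightarrow> int"
        using rs I by (subst I') simp
      from this[of c] this[of "c(r := M, s := 0)"]
      show "(\<Sum>i\<in>I. (c(r := M, s := 0)) i) = 0"
        using Suc.prems(3) rs(3,6) rest by simp
      have rest: "(\<Sum>i\<in>I - {r, s}. real_of_int ((c(r := M, s := 0)) i) *\<^sub>R (g(r := u)) i) =
          (\<Sum>i\<in>I - {r, s}. real_of_int (c i) *\<^sub>R g i)"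
        by (intro sum.cong) auto
      have "(\<Sum>i\<in>I. d i) = d r + d s + (\<Sum>i\<in>I - {r, s}. d i)" for d :: "nat \<Rightarrow> real ^ 'n"
        using rs I by (subst I') simp
      from this[of "\<lambda>i. real_of_int (c i) *\<^sub>R g i"]
        this[of "\<lambda>i. real_of_int ((c(r := M, s := 0)) i) *\<^sub>R (g(r := u)) i"]
      show "(\<Sum>i\<in>I. real_of_int ((c(r := M, s := 0)) i) *\<^sub>R (g(r := u)) i) = 0"
        using sumg rs(3,8) rest by simp
    qed
    moreover have "(g(r := u)) ` I = insert (g s) (insert u W)"
      using rs by (subst I') (auto simp: rs(7))
    ultimately show ?thesis by simp
  qed
  have "poly_seq e (\<lambda>k. f ((*\<^sub>R) (real k) ` (convex hull (insert (g a) (insert (g b) W)))))"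
  proof (rule poly_seq_split_edge[OF f])
    show "0 \<le> t" "t \<le> 1" using a b M by (auto simp: t_def M_def)
    show "u = (1 - t) *\<^sub>R g a + t *\<^sub>R g b"
    proof -
      have "1 - t = real_of_int (c a) / real_of_int M"
        using M by (simp add: t_def M_def field_simps)
      then show ?thesis using M by (simp add: t_def u_def g_def)
    qed
    show "poly_seq e (\<lambda>k. f ((*\<^sub>R) (real k) ` (convex hull (insert (g a) (insert u W)))))"
      by (rule half[of b a]) (use a b ug in \<open>auto simp: M_def W_def insert_commute add.commute\<close>)
    show "poly_seq e (\<lambda>k. f ((*\<^sub>R) (real k) ` (convex hull (insert (g b) (insert u W)))))"
      by (rule half[of a b]) (use a b ug in \<open>auto simp: M_def W_def\<close>)
    have "insert u W = (g(a := u)) ` (I - {b})"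
      using a b by (auto simp: W_def image_iff)
    moreover have "card (I - {b}) < card I" using I b by (intro psubset_card_mono) auto
    moreover have "(g(a := u)) ` (I - {b}) \<subseteq> integer_lattice" using gL uL by auto
    ultimately show "poly_seq e (\<lambda>k. f ((*\<^sub>R) (real k) ` (convex hull (insert u W))))"
      using fewer[of "I - {b}" "g(a := u)"] I by simp
  qed (use I a b gL uL in \<open>auto simp: W_def\<close>)
  moreover have "insert (g a) (insert (g b) W) = (*\<^sub>R) (real_of_int M) ` h ` I"
    using a b by (auto simp: W_def g_def image_iff)
  moreover have "(*\<^sub>R) (real k) ` (*\<^sub>R) (real_of_int M) ` X = (*\<^sub>R) (real (nat M * k)) ` X" for k and X :: "(real ^ 'n) set"
    using M by (simp add: image_image mult.commute)
  ultimately have dilated: "poly_seq e (\<lambda>k. f ((*\<^sub>R) (real (nat M * k)) ` (convex hull (h ` I))))"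
    by (simp flip: dilate_hull)
  obtain e' where "poly_seq e' (\<lambda>k. f ((*\<^sub>R) (real k) ` (convex hull (h ` I))))"
    using poly[OF hull_in_lattice_polytopes[of "h ` I"]] I Suc.prems(1) by auto
  moreover have "nat M > 0" using M by simp
  ultimately show ?case using poly_seq_unscale dilated by blast
qed

text \<open>
  At most \<open>CARD('n) + 1\<close> points need no reduction, as the bound by their number is already the
  bound by the dimension; more points are affinely dependent with integer coefficients.
\<close>

theorem poly_seq_dilate:
  fixes f :: "(real ^ 'n) set \<Rightarrow> real"
  assumes f: "weak_valuation f" "translation_poly d f" and f0: "f {} = 0" and P: "P \<in> lattice_polytopes"
  shows "poly_seq (CARD('n) + d) (\<lambda>k. f ((*\<^sub>R) (real k) ` P))"
proof -
  have basic: "poly_seq (card V - 1 + d) (\<lambda>k. f ((*\<^sub>R) (real k) ` (convex hull V)))"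
    if "finite V" "V \<subseteq> integer_lattice" for V
  proof (cases "V = {}")
    case True
    then show ?thesis using f0 by (simp add: poly_seq_zero)
  next
    case False
    then have "poly_seq (card V - 1 + d) (\<lambda>k. f ((*\<^sub>R) (real k) ` (convex hull V) + {0}))"
      using poly_seq_dilate_plus[OF f that(1) _ that(2) lattice_polytopes_singleton[OF integer_lattice_0]] by blast
    then show ?thesis by simp
  qed
  have poly: "\<exists>e. poly_seq e (\<lambda>k. f ((*\<^sub>R) (real k) ` Q))" if "Q \<in> lattice_polytopes" for Q
    using that basic by (auto simp: lattice_polytope_iff)
  have family: "poly_seq (CARD('n) + d) (\<lambda>k. f ((*\<^sub>R) (real k) ` (convex hull (h ` I))))"
    if "finite I" "h ` I \<subseteq> integer_lattice" for h and I :: "nat set"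
    using that
  proof (induction "card I" arbitrary: I h rule: less_induct)
    case less
    show ?case
    proof (cases "card I \<le> CARD('n) + 1")
      case True
      then have "card (h ` I) \<le> CARD('n) + 1" using card_image_le[OF less.prems(1)] order_trans by blast
      then show ?thesis
        using less.prems by (intro poly_seq_mono[OF basic]) auto
    next
      case False
      then have "CARD('n) + 2 \<le> card I" by simp
      then obtain c :: "nat \<Rightarrow> int" where c: "\<exists>i\<in>I. c i \<noteq> 0" "(\<Sum>i\<in>I. c i) = 0"
          "(\<Sum>i\<in>I. real_of_int (c i) *\<^sub>R h i) = 0"
        using integer_affine_dependence[OF less.prems(1) _ less.prems(2)] by blast
      have "\<exists>i\<in>I. c i > 0"
      proof (rule ccontr)
        assume "\<not> (\<exists>i\<in>I. c i > 0)"
        then have "\<forall>i\<in>I. - c i = 0"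
          using less.prems(1) c(2) by (subst sum_nonneg_eq_0_iff[symmetric]) (auto simp: sum_negf not_less)
        then show False using c(1) by auto
      qed
      then have "card {i\<in>I. c i > 0} \<noteq> 0" using less.prems(1) by auto
      then obtain p where p: "card {i\<in>I. c i > 0} = Suc p" using not0_implies_Suc by blast
      show ?thesis
        by (rule poly_seq_dependent_hull[OF f(1) poly less.hyps less.prems p c(2,3)])
    qed
  qed
  obtain V where V: "finite V" "V \<subseteq> integer_lattice" "P = convex hull V"
    using P by (auto simp: lattice_polytope_iff)
  obtain h :: "nat \<Rightarrow> real ^ 'n" and n where "V = h ` {i. i < n}"
    using V(1) by (metis finite_imp_nat_seg_image_inj_on)
  then show ?thesis using family[of "{i. i < n}" h] V by auto
qed

section \<open>Homogeneous decomposition\<close>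

lemma sym_tensors_sum:
  fixes T :: "'k \<Rightarrow> ('n::finite) tensor"
  assumes "\<And>k. k \<in> K \<Longrightarrow> T k \<in> sym_tensors r"
  shows "(\<lambda>v. \<Sum>k\<in>K. b k * T k v) \<in> sym_tensors r"
  unfolding sym_tensors_def
proof (intro CollectI conjI allI impI)
  fix v w :: "nat \<Rightarrow> (real, 'n) vec" assume "\<forall>i<r. v i = w i"
  then have "T k v = T k w" if "k \<in> K" for k
    using assms[OF that] by (auto simp: sym_tensors_def)
  then show "(\<Sum>k\<in>K. b k * T k v) = (\<Sum>k\<in>K. b k * T k w)" by (intro sum.cong) auto
next
  fix v :: "nat \<Rightarrow> (real, 'n) vec" and i assume "i < r"
  then have "linear (\<lambda>x. T k (v(i := x)))" if "k \<in> K" for k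
    using assms[OF that] by (auto simp: sym_tensors_def)
  then show "linear (\<lambda>x. \<Sum>k\<in>K. b k * T k (v(i := x)))"
    using linear_compose_scale_right[where 'b = real] by (intro linear_compose_sum) force
next
  fix v :: "nat \<Rightarrow> (real, 'n) vec" and \<sigma> assume "\<sigma> permutes {..<r}"
  then have "T k (v \<circ> \<sigma>) = T k v" if "k \<in> K" for k
    using assms[OF that] by (auto simp: sym_tensors_def)
  then show "(\<Sum>k\<in>K. b k * T k (v \<circ> \<sigma>)) = (\<Sum>k\<in>K. b k * T k v)" by (intro sum.cong) auto
qed

lemma tensor_mult_sum_left:
  "tensor_mult p q (\<lambda>v. \<Sum>k\<in>K. b k * A k v) B v = (\<Sum>k\<in>K. b k * tensor_mult p q (A k) B v)"
  unfolding tensor_mult_def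
  by (simp add: sum_distrib_left sum_distrib_right, subst sum.swap, simp add: mult_ac)

lemma tensor_mult_power_scale:
  "tensor_mult p q A (tensor_power (s *\<^sub>R y) q) v = s ^ q * tensor_mult p q A (tensor_power y q) v"
proof -
  have "A a * (\<Prod>i<q. (s *\<^sub>R y) \<bullet> b i) = s ^ q * (A a * (\<Prod>i<q. y \<bullet> b i))" for a b
    by (simp add: prod.distrib)
  then show ?thesis
    unfolding tensor_mult_def tensor_power_def by (simp only: sum_distrib_left mult.left_commute)
qed

lemma lattice_poly_tensor_mult:
  assumes "j \<le> r"
  shows "lattice_poly (Suc r) (\<lambda>y. tensor_mult p j A (tensor_power y j) v)"
proof -
  have "lattice_poly (Suc r) (\<lambda>y. \<Prod>i<j. y \<bullet> v (\<sigma> (p + i)))" for \<sigma> :: "nat \<Rightarrow> nat"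
    using assms by (intro lattice_poly_mono[OF _ lattice_poly_prod_inner]) simp
  then show ?thesis
    unfolding tensor_mult_def tensor_power_def by (intro lattice_poly_cmult lattice_poly_sum)
qed

theorem theorem14:
  fixes Z :: "(real ^ 'n) set \<Rightarrow> 'n tensor" and r :: nat
  assumes "CARD('n) \<ge> 2" and "r \<ge> 1"
    and "valuation r Z" and "translation_covariant r Z"
  shows "\<exists>Zs :: nat \<Rightarrow> (real ^ 'n) set \<Rightarrow> 'n tensor.
     (\<forall>i\<le>CARD('n) + r. Zs i \<in> lattice_polytopes \<rightarrow> sym_tensors r) \<and>
     (\<forall>k::nat. \<forall>P\<in>lattice_polytopes.
        Z ((\<lambda>x. real k *\<^sub>R x) ` P) = (\<lambda>v. \<Sum>i\<le>CARD('n) + r. Zs i P v * real k ^ i)) \<and>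
     (\<forall>i\<le>CARD('n) + r. valuation r (Zs i) \<and> translation_covariant r (Zs i) \<and> homogeneous i (Zs i))"
proof -
  define N where "N = CARD('n) + r"
  have Z0: "Z {} = (\<lambda>v. 0)" and Zsym: "\<And>P. P \<in> lattice_polytopes \<Longrightarrow> Z P \<in> sym_tensors r"
    and Zval: "\<And>v. weak_valuation (\<lambda>P. Z P v)"
    using assms(3) by (auto simp: valuation_def weak_valuation_def fun_eq_iff)
  obtain Za :: "nat \<Rightarrow> (real ^ 'n) set \<Rightarrow> 'n tensor"
    where Za': "\<forall>j\<le>r. Za j \<in> lattice_polytopes \<rightarrow> sym_tensors j"
      and cov: "\<forall>P\<in>lattice_polytopes. \<forall>y\<in>integer_lattice. Z ((\<lambda>x. x + y) ` P) =
        (\<lambda>v. \<Sum>j\<le>r. tensor_mult (r - j) j (Za (r - j) P) (tensor_power y j) v / fact j)"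
    using assms(4) unfolding translation_covariant_def by blast
  have Za: "Za j P \<in> sym_tensors j" if "j \<le> r" "P \<in> lattice_polytopes" for j P
    using Za' that by blast
  note cov = cov[rule_format]
  have Ztrans: "translation_poly (Suc r) (\<lambda>P. Z P v)" for v
    unfolding translation_poly_def
  proof
    fix P :: "(real ^ 'n) set" assume P: "P \<in> lattice_polytopes"
    define \<phi> where "\<phi> = (\<lambda>y. \<Sum>j\<le>r. (1 / fact j) * tensor_mult (r - j) j (Za (r - j) P) (tensor_power y j) v)"
    have \<phi>: "lattice_poly (Suc r) \<phi>"
      unfolding \<phi>_def by (intro lattice_poly_sum lattice_poly_cmult lattice_poly_tensor_mult) simp
    have eq: "Z (P + {y}) v = \<phi> y" if "y \<in> integer_lattice" for y
    proof -
      have "P + {y} = (\<lambda>x. x + y) ` P" by (auto simp: set_plus_def)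
      then show ?thesis using cov[OF P that] by (simp add: \<phi>_def)
    qed
    show "lattice_poly (Suc r) (\<lambda>y. Z (P + {y}) v)"
      by (rule iffD2[OF lattice_poly_cong[OF eq] \<phi>])
  qed
  have coeffs: "\<exists>a. \<forall>k. Z ((*\<^sub>R) (real k) ` P) v = (\<Sum>i\<le>N. a i * real k ^ i)"
    if P: "P \<in> lattice_polytopes" for P v
  proof -
    have "poly_seq (Suc N) (\<lambda>k. Z ((*\<^sub>R) (real k) ` P) v)"
      using poly_seq_dilate[OF Zval[of v] Ztrans[of v] _ P] Z0 by (simp add: N_def)
    then obtain p where p: "\<forall>i\<ge>Suc N. coeff p i = 0" "\<And>k. Z ((*\<^sub>R) (real k) ` P) v = poly p (real k)"
      by (auto simp: poly_seq_def)
    have "degree p \<le> N"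
      using p(1) by (intro degree_le) auto
    then have "poly p x = (\<Sum>i\<le>N. coeff p i * x ^ i)" for x
      unfolding poly_altdef by (intro sum.mono_neutral_left) (auto simp: coeff_eq_0)
    then show ?thesis using p(2) by auto
  qed
  obtain c :: "nat \<Rightarrow> nat \<Rightarrow> real"
    where c: "\<And>a i. i \<le> N \<Longrightarrow> (\<Sum>k\<le>N. c i k * (\<Sum>j\<le>N. a j * real k ^ j)) = a i"
    using poly_interpolation[of N] by blast
  define Zs where "Zs i P = (\<lambda>v. \<Sum>k\<le>N. c i k * Z ((*\<^sub>R) (real k) ` P) v)" for i P
  have scaleL: "(*\<^sub>R) (real k) ` P \<in> lattice_polytopes" if "P \<in> lattice_polytopes" for k P
    using that by (intro lattice_polytopes_scale) auto
  have expand: "Z ((*\<^sub>R) (real k) ` P) v = (\<Sum>i\<le>N. Zs i P v * real k ^ i)"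
    if P: "P \<in> lattice_polytopes" for k P v
  proof -
    obtain a where a: "\<And>k. Z ((*\<^sub>R) (real k) ` P) v = (\<Sum>i\<le>N. a i * real k ^ i)"
      using coeffs[OF P, of v] by blast
    have "Zs i P v = a i" if "i \<le> N" for i
      unfolding Zs_def a by (rule c[OF that])
    then show ?thesis by (simp add: a)
  qed
  have sym: "Zs i P \<in> sym_tensors r" if "P \<in> lattice_polytopes" for i P
    unfolding Zs_def using that by (intro sym_tensors_sum Zsym scaleL)
  have hom: "homogeneous i (Zs i)" if i: "i \<le> N" for i
    unfolding homogeneous_def
  proof (intro allI ballI ext)
    fix m P v assume P: "P \<in> (lattice_polytopes :: (real ^ 'n) set set)"
    have "Zs i ((*\<^sub>R) (real m) ` P) v = (\<Sum>k\<le>N. c i k * Z ((*\<^sub>R) (real (k * m)) ` P) v)"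
      by (simp add: Zs_def image_image)
    also have "\<dots> = (\<Sum>k\<le>N. c i k * (\<Sum>j\<le>N. (real m ^ j * Zs j P v) * real k ^ j))"
      unfolding expand[OF P] by (simp add: power_mult_distrib mult_ac)
    also have "\<dots> = real m ^ i * Zs i P v" by (rule c[OF i])
    finally show "Zs i ((*\<^sub>R) (real m) ` P) v = real m ^ i * Zs i P v" .
  qed
  have val: "valuation r (Zs i)" for i
    unfolding valuation_def
  proof (intro conjI allI impI ext)
    show "Zs i \<in> lattice_polytopes \<rightarrow> sym_tensors r" using sym by blast
    show "Zs i {} v = 0" for v by (simp add: Zs_def Z0)
    fix P Q :: "(real ^ 'n) set" and v
    assume "P \<in> lattice_polytopes \<and> Q \<in> lattice_polytopes \<and> P \<union> Q \<in> lattice_polytopes \<and> P \<inter> Q \<in> lattice_polytopes"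
    then have L: "P \<in> lattice_polytopes" "Q \<in> lattice_polytopes" "P \<union> Q \<in> lattice_polytopes" "P \<inter> Q \<in> lattice_polytopes"
      by auto
    show "Zs i P v + Zs i Q v = Zs i (P \<union> Q) v + Zs i (P \<inter> Q) v"
    proof (cases "P = {} \<or> Q = {}")
      case True
      then show ?thesis by (auto simp: Zs_def Z0)
    next
      case False
      \<comment> \<open>A nonempty intersection is what makes dilation by \<open>k = 0\<close> commute with intersection.\<close>
      have ne: "P \<inter> Q \<noteq> {}"
      proof
        assume "P \<inter> Q = {}"
        then have "P \<inter> Q \<inter> (P \<union> Q) = {}" by simp
        with connected_closedD[OF convex_connected[OF lattice_polytope_convex[OF L(3)]] _ order_refl
            lattice_polytope_closed[OF L(1)] lattice_polytope_closed[OF L(2)]]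
        have "P \<inter> (P \<union> Q) = {} \<or> Q \<inter> (P \<union> Q) = {}" by blast
        then show False using False by blast
      qed
      have "Z ((*\<^sub>R) (real k) ` P) v + Z ((*\<^sub>R) (real k) ` Q) v =
          Z ((*\<^sub>R) (real k) ` (P \<union> Q)) v + Z ((*\<^sub>R) (real k) ` (P \<inter> Q)) v" for k
      proof -
        have int: "(*\<^sub>R) (real k) ` (P \<inter> Q) = (*\<^sub>R) (real k) ` P \<inter> (*\<^sub>R) (real k) ` Q"
        proof (cases "k = 0")
          case True
          then show ?thesis using ne by auto
        next
          case False
          then show ?thesis by (intro image_Int) (auto intro: injI)
        qed
        show ?thesis
          using weak_valuationD[OF Zval[of v] scaleL[OF L(1), of k] scaleL[OF L(2), of k]]
            scaleL[OF L(3), of k] scaleL[OF L(4), of k] by (simp add: int image_Un)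
      qed
      then show ?thesis
        by (simp add: Zs_def flip: sum.distrib distrib_left)
    qed
  qed
  \<comment> \<open>The translation by \<open>k y\<close> of the \<open>k\<close>-th dilate contributes the factor \<open>k ^ (r - s)\<close> to the associated
    function of rank \<open>s\<close>; the linear combination with the weights \<open>c i k\<close> is again a symmetric tensor.\<close>
  have trans: "translation_covariant r (Zs i)" for i
    unfolding translation_covariant_def
  proof (intro exI[of _ "\<lambda>s P v. \<Sum>k\<le>N. (c i k * real k ^ (r - s)) * Za s ((*\<^sub>R) (real k) ` P) v"] conjI allI impI ballI ext)
    fix j assume "j \<le> r"
    then show "(\<lambda>P v. \<Sum>k\<le>N. (c i k * real k ^ (r - j)) * Za j ((*\<^sub>R) (real k) ` P) v) \<in> lattice_polytopes \<rightarrow> sym_tensors j"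
      by (intro Pi_I sym_tensors_sum Za scaleL)
  next
    fix P :: "(real ^ 'n) set" and y :: "real ^ 'n" and v
    assume P: "P \<in> lattice_polytopes" and y: "y \<in> integer_lattice"
    have "Zs i ((\<lambda>x. x + y) ` P) v = (\<Sum>k\<le>N. c i k * Z ((\<lambda>x. x + real k *\<^sub>R y) ` (*\<^sub>R) (real k) ` P) v)"
      by (simp add: Zs_def image_image scaleR_add_right)
    also have "\<dots> = (\<Sum>k\<le>N. \<Sum>j\<le>r. (c i k * real k ^ j) *
        tensor_mult (r - j) j (Za (r - j) ((*\<^sub>R) (real k) ` P)) (tensor_power y j) v / fact j)"
    proof (intro sum.cong refl)
      fix k
      have "real k *\<^sub>R y \<in> integer_lattice" using y by (intro integer_lattice_scale) auto
      then show "c i k * Z ((\<lambda>x. x + real k *\<^sub>R y) ` (*\<^sub>R) (real k) ` P) v =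
          (\<Sum>j\<le>r. (c i k * real k ^ j) *
        tensor_mult (r - j) j (Za (r - j) ((*\<^sub>R) (real k) ` P)) (tensor_power y j) v / fact j)"
        by (simp add: cov[OF scaleL[OF P]] tensor_mult_power_scale sum_distrib_left mult_ac)
    qed
    also have "\<dots> = (\<Sum>j\<le>r. \<Sum>k\<le>N. (c i k * real k ^ j) *
        tensor_mult (r - j) j (Za (r - j) ((*\<^sub>R) (real k) ` P)) (tensor_power y j) v / fact j)"
      by (rule sum.swap)
    also have "\<dots> = (\<Sum>j\<le>r. tensor_mult (r - j) j
        (\<lambda>v. \<Sum>k\<le>N. (c i k * real k ^ (r - (r - j))) * Za (r - j) ((*\<^sub>R) (real k) ` P) v) (tensor_power y j) v / fact j)"
      by (intro sum.cong refl) (simp add: tensor_mult_sum_left sum_divide_distrib)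
    finally show "Zs i ((\<lambda>x. x + y) ` P) v = (\<Sum>j\<le>r. tensor_mult (r - j) j
        (\<lambda>v. \<Sum>k\<le>N. (c i k * real k ^ (r - (r - j))) * Za (r - j) ((*\<^sub>R) (real k) ` P) v) (tensor_power y j) v / fact j)" .
  qed
  show ?thesis
    using sym expand val trans hom unfolding N_def[symmetric]
    by (intro exI[of _ Zs] conjI allI impI ballI ext) auto
qed

end
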